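(* Let $(Z_t)_{t\in\mathbb{Z}}$ be a real-valued, zero-mean stationary Gaussian process with covariance function $r(t)=\mathrm{cov}(Z_0,Z_t)$, $t\in\mathbb{Z}$. Assume that there exist $T_0>0$, constants $J_1,J_2<0$ and a parameter $\chi\in(-2,-1)$ such that $$J_1t^{\chi}\le r(t)\le J_2t^{\chi}\quad\text{for all } t\ge T_0,$$ and that $\sum_{t\in\mathbb{Z}}r(t)=0$. Let $S_0=0$, $S_t=S_{t-1}+Z_t$ for $t\ge 1$, and let $\alpha>1$. If $\lambda>0$ is small enough (i.e. there is $\lambda_0>0$, depending on $\alpha$ and on the process $Z$, such that the following holds for every $0<\lambda<\lambda_0$), then the maximal expected profits $u(T)$ in the market with price process $S$ and price impact parameters $\lambda,\alpha$ (defined in the context) satisfy $$\limsup_{T\to\infty}\frac{u(T)}{T^{\left(\frac{\chi}{2}+1\right)\left(1+\frac{1}{\alpha-1}\right)+1}}<\infty,$$ and the strategy $\phi(T,\alpha)=(\phi_t(T,\alpha))_{t=0}^T$ given by $$\phi_t(T,\alpha):=\begin{cases}-\mathrm{sgn}(S_t)|S_t|^{\frac{1}{\alpha-1}}, & 0\le t\le 3\lfloor T/6\rfloor,\\[2pt] -\dfrac{1}{3\lfloor T/6\rfloor}\displaystyle\sum_{s=0}^{3\lfloor T/6\rfloor}\phi_s(T,\alpha), & 3\lfloor T/6\rfloor<t\le 6\lfloor T/6\rfloor,\\[2pt] 0,&\text{otherwise}\end{cases}$$ satisfies $$\liminf_{T\to\infty}\frac{E[X_T(\phi(T,\alpha)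)]}{T^{\left(\frac{\chi}{2}+1\right)\left(1+\frac{1}{\alpha-1}\right)+1}}>0.$$
   Context: All random variables live on a probability space $(\Omega,\mathcal{F},P)$ with expectation $E$. The filtration is $\mathcal{F}_n:=\sigma(Z_i,\ i\le n)$. $S_t$, $t\in\mathbb{N}=\{0,1,2,\dots\}$, is the price of a risky asset; the riskless asset has constant price $1$. $\mathrm{sgn}(0)=0$ and $x_-:=\max\{-x,0\}$. For $T\in\mathbb{N}$, the feasible strategies are $$\mathcal{S}(T):=\{\phi=(\phi_t)_{t=0}^T:\ \phi\text{ is an }\mathbb{R}\text{-valued process adapted to }(\mathcal{F}_t)\},$$ where $\phi_t$ is the change at time $t$ in the investor's position in the risky asset. Initial positions in both assets are zero. The strategies which liquidate the risky asset by the end of the trading period are $$\mathcal{G}(T):=\Big\{\phi\in\mathcal{S}(T):\ \sum_{u=0}^T\phi_u=0\Big\}.$$ For $\phi\in\mathcal{G}(T)$, the terminal cash position under price impact with parameters $\lambda>0$, $\alpha>1$ is $$X_T(\phi):=-\sum_{u=0}^T\phi_uS_u-\sum_{u=0}^T\lambda|\phi_u|^{\alpha}.$$ Let $$\mathcal{A}(T):=\{\phi\in\mathcal{G}(T):\ E[(X_T(\phi))_-]<\infty\},\qquad u(T):=\sup_{\phi\in\mathcal{A}(T)}E[X_T(\phi)].$$ *)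

theory Defs
  imports "HOL-Probability.Probability"
begin

section \<open>Stationary Gaussian processes\<close>

text \<open>Point masses count as (degenerate) Gaussian laws.\<close>

definition gaussian_rv :: "'a measure \<Rightarrow> ('a \<Rightarrow> real) \<Rightarrow> bool" where
  "gaussian_rv M X \<longleftrightarrow> X \<in> borel_measurable M \<and>
     ((\<exists>m. distr M borel X = return borel m) \<or>
      (\<exists>m \<sigma>. 0 < \<sigma> \<and> distributed M lborel X (\<lambda>x. ennreal (normal_density m \<sigma> x))))"

definition gaussian_process :: "'a measure \<Rightarrow> (int \<Rightarrow> 'a \<Rightarrow> real) \<Rightarrow> bool" where
  "gaussian_process M Z \<longleftrightarrow> (\<forall>t. Z t \<in> borel_measurable M) \<and>
     (\<forall>J c. finite J \<longrightarrow> gaussian_rv M (\<lambda>\<omega>. \<Sum>j\<in>J. c j * Z j \<omega>))"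

definition stationary_process :: "'a measure \<Rightarrow> (int \<Rightarrow> 'a \<Rightarrow> real) \<Rightarrow> bool" where
  "stationary_process M Z \<longleftrightarrow> (\<forall>t. Z t \<in> borel_measurable M) \<and>
     (\<forall>J h. finite J \<longrightarrow>
        distr M (\<Pi>\<^sub>M j\<in>J. borel) (\<lambda>\<omega>. \<lambda>j\<in>J. Z (j + h) \<omega>) =
        distr M (\<Pi>\<^sub>M j\<in>J. borel) (\<lambda>\<omega>. \<lambda>j\<in>J. Z j \<omega>))"

definition cov :: "'a measure \<Rightarrow> ('a \<Rightarrow> real) \<Rightarrow> ('a \<Rightarrow> real) \<Rightarrow> real" where
  "cov M X Y = (LINT \<omega>|M. (X \<omega> - (LINT \<omega>'|M. X \<omega>')) * (Y \<omega> - (LINT \<omega>'|M. Y \<omega>')))"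

section \<open>Market with superlinear price impact\<close>

text \<open>The filtration is indexed by the natural numbers but carries the whole past of
  \<open>Z\<close>, including all negative times.\<close>

definition past_filtration :: "'a measure \<Rightarrow> (int \<Rightarrow> 'a \<Rightarrow> real) \<Rightarrow> nat \<Rightarrow> 'a measure" where
  "past_filtration M Z n =
     sigma (space M) {Z i -` B \<inter> space M | i B. i \<le> int n \<and> B \<in> sets borel}"

primrec price :: "(int \<Rightarrow> 'a \<Rightarrow> real) \<Rightarrow> nat \<Rightarrow> 'a \<Rightarrow> real" where
  "price Z 0 \<omega> = 0"
| "price Z (Suc t) \<omega> = price Z t \<omega> + Z (int (Suc t)) \<omega>"

text \<open>A strategy on \<open>{0..T}\<close> is a function on all of \<open>nat\<close>; its values after \<open>T\<close> are
  unconstrained and enter neither the constraints nor the terminal cash position.\<close>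

definition feasible :: "'a measure \<Rightarrow> (int \<Rightarrow> 'a \<Rightarrow> real) \<Rightarrow> nat \<Rightarrow> (nat \<Rightarrow> 'a \<Rightarrow> real) set" where
  "feasible M Z T = {\<phi>. \<forall>t\<le>T. \<phi> t \<in> borel_measurable (past_filtration M Z t)}"

definition liquidating :: "'a measure \<Rightarrow> (int \<Rightarrow> 'a \<Rightarrow> real) \<Rightarrow> nat \<Rightarrow> (nat \<Rightarrow> 'a \<Rightarrow> real) set" where
  "liquidating M Z T = {\<phi> \<in> feasible M Z T. \<forall>\<omega>\<in>space M. (\<Sum>u=0..T. \<phi> u \<omega>) = 0}"

definition terminal_cash ::
    "(int \<Rightarrow> 'a \<Rightarrow> real) \<Rightarrow> real \<Rightarrow> real \<Rightarrow> nat \<Rightarrow> (nat \<Rightarrow> 'a \<Rightarrow> real) \<Rightarrow> 'a \<Rightarrow> real" where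
  "terminal_cash Z lam \<alpha> T \<phi> \<omega> =
     - (\<Sum>u=0..T. \<phi> u \<omega> * price Z u \<omega>) - (\<Sum>u=0..T. lam * \<bar>\<phi> u \<omega>\<bar> powr \<alpha>)"

text \<open>Extended expectation \<open>E X = E X\<^sup>+ - E X\<^sup>-\<close>. If the negative part is not integrable the
  value is \<open>-\<infinity>\<close>; in particular \<open>\<infinity> - \<infinity>\<close> never counts as a gain (in type \<open>ereal\<close> it would be
  \<open>\<infinity>\<close>).\<close>

definition ext_expectation :: "'a measure \<Rightarrow> ('a \<Rightarrow> real) \<Rightarrow> ereal" where
  "ext_expectation M X =
     (if (\<integral>\<^sup>+\<omega>. ennreal (max (- X \<omega>) 0) \<partial>M) = \<infinity> then - \<infinity>
      else enn2ereal (\<integral>\<^sup>+\<omega>. ennreal (max (X \<omega>) 0) \<partial>M)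
           - enn2ereal (\<integral>\<^sup>+\<omega>. ennreal (max (- X \<omega>) 0) \<partial>M))"

definition admissible ::
    "'a measure \<Rightarrow> (int \<Rightarrow> 'a \<Rightarrow> real) \<Rightarrow> real \<Rightarrow> real \<Rightarrow> nat \<Rightarrow> (nat \<Rightarrow> 'a \<Rightarrow> real) set" where
  "admissible M Z lam \<alpha> T = {\<phi> \<in> liquidating M Z T.
     (\<integral>\<^sup>+\<omega>. ennreal (max (- terminal_cash Z lam \<alpha> T \<phi> \<omega>) 0) \<partial>M) < \<infinity>}"

definition max_profit ::
    "'a measure \<Rightarrow> (int \<Rightarrow> 'a \<Rightarrow> real) \<Rightarrow> real \<Rightarrow> real \<Rightarrow> nat \<Rightarrow> ereal" where
  "max_profit M Z lam \<alpha> T =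
     (SUP \<phi>\<in>admissible M Z lam \<alpha> T. ext_expectation M (terminal_cash Z lam \<alpha> T \<phi>))"

definition contrarian_trade :: "(int \<Rightarrow> 'a \<Rightarrow> real) \<Rightarrow> real \<Rightarrow> nat \<Rightarrow> 'a \<Rightarrow> real" where
  "contrarian_trade Z \<alpha> t \<omega> = - sgn (price Z t \<omega>) * \<bar>price Z t \<omega>\<bar> powr (1 / (\<alpha> - 1))"

definition contrarian_strategy ::
    "(int \<Rightarrow> 'a \<Rightarrow> real) \<Rightarrow> nat \<Rightarrow> real \<Rightarrow> nat \<Rightarrow> 'a \<Rightarrow> real" where
  "contrarian_strategy Z T \<alpha> t \<omega> =
     (if t \<le> 3 * (T div 6) then contrarian_trade Z \<alpha> t \<omega>
      else if t \<le> 6 * (T div 6) then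
        - (1 / real (3 * (T div 6))) * (\<Sum>s=0..3 * (T div 6). contrarian_trade Z \<alpha> s \<omega>)
      else 0)"

end

theory Submission
  imports Defs
begin

text \<open>
  Maximising \<open>- x s - \<lambda> \<bar>x\<bar>\<^sup>\<alpha>\<close> over the trade \<open>x\<close> at each time separately bounds every profit by
  a constant times \<open>\<Sum>\<^sub>t \<bar>S\<^sub>t\<bar>\<^sup>\<beta>\<close> with \<open>\<beta> = \<alpha> / (\<alpha> - 1)\<close>. As \<open>S\<^sub>t\<close> is Gaussian with variance of
  order \<open>t\<close> to the power \<open>\<chi> + 2\<close>, this has the claimed order.

  The contrarian strategy earns \<open>(1 - \<lambda>) \<Sum>\<^sub>s \<bar>S\<^sub>s\<bar>\<^sup>\<beta>\<close> in its first phase, while for small \<open>\<lambda>\<close> the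
  liquidation essentially costs averages over \<open>t\<close> of \<open>E[sgn(S\<^sub>s) \<bar>S\<^sub>s\<bar>\<^sup>\<beta>\<^sup>-\<^sup>1 S\<^sub>t]\<close>, which equals
  \<open>E \<bar>S\<^sub>s\<bar>\<^sup>\<beta> \<cdot> cov(S\<^sub>s, S\<^sub>t) / var(S\<^sub>s)\<close>. Since the covariances of \<open>Z\<close> are eventually negative,
  \<open>cov(S\<^sub>s, S\<^sub>t) - var(S\<^sub>s)\<close> is bounded above, and it is at most a negative multiple of
  \<open>var(S\<^sub>s)\<close>, up to a bounded error, when \<open>s\<close> lies in the middle third of the first phase. The
  first phase therefore exceeds the liquidation cost by an amount of the full order.
\<close>

section \<open>Power inequalities\<close>

text \<open>Young's inequality for |x + y| and |x|^(\<beta> - 1), with conjugate exponents \<beta>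
  and \<beta> / (\<beta> - 1), rearranges to the tangent inequality of the convex function
  |.|^\<beta>.\<close>

lemma convex_abs_powr_tangent:
  fixes x y \<beta> :: real
  assumes "\<beta> > 1"
  shows "\<bar>x\<bar> powr \<beta> + \<beta> * (sgn x * \<bar>x\<bar> powr (\<beta> - 1)) * y \<le> \<bar>x + y\<bar> powr \<beta>"
proof (cases "x = 0")
  case True
  then show ?thesis by simp
next
  case False
  define z where "z = x + y"
  have "\<bar>z\<bar> * \<bar>x\<bar> powr (\<beta> - 1) \<le> \<bar>z\<bar> powr \<beta> / \<beta> + (\<bar>x\<bar> powr (\<beta> - 1)) powr (\<beta> / (\<beta> - 1)) / (\<beta> / (\<beta> - 1))"
    using assms by (intro Youngs_inequality) (auto simp: field_simps)
  also have "(\<bar>x\<bar> powr (\<beta> - 1)) powr (\<beta> / (\<beta> - 1)) = \<bar>x\<bar> powr \<beta>"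
    using assms by (simp add: powr_powr)
  finally have young: "\<beta> * (\<bar>z\<bar> * \<bar>x\<bar> powr (\<beta> - 1)) \<le> \<bar>z\<bar> powr \<beta> + (\<beta> - 1) * \<bar>x\<bar> powr \<beta>"
    using assms by (simp add: field_simps)
  have split: "\<bar>x\<bar> powr \<beta> = \<bar>x\<bar> powr (\<beta> - 1) * \<bar>x\<bar>"
    using False by (simp add: powr_diff)
  have "\<beta> * ((sgn x * \<bar>x\<bar> powr (\<beta> - 1)) * z) \<le> \<beta> * (\<bar>z\<bar> * \<bar>x\<bar> powr (\<beta> - 1))"
    using assms by (intro mult_left_mono) (auto simp: sgn_if mult_le_cancel_right mult_left_mono mult.commute[of "\<bar>x\<bar> powr (\<beta> - 1)"])
  also note young
  finally have "\<beta> * ((sgn x * \<bar>x\<bar> powr (\<beta> - 1)) * z) \<le> \<bar>z\<bar> powr \<beta> + (\<beta> - 1) * \<bar>x\<bar> powr \<beta>" .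
  moreover have "sgn x * \<bar>x\<bar> powr (\<beta> - 1) * x = \<bar>x\<bar> powr \<beta>"
    unfolding split by (simp add: sgn_if)
  ultimately show ?thesis
    unfolding z_def by (simp add: algebra_simps)
qed

text \<open>Jensen's inequality for uniform weights on \<open>I\<close>: the tangent inequality is
  summed at the mean, where the linear terms cancel. Later it bounds the impact cost of spreading
  the liquidation evenly.\<close>

lemma abs_sum_powr_le:
  fixes x :: "'b \<Rightarrow> real"
  assumes "\<alpha> > 1" "finite I" "I \<noteq> {}"
  shows "real (card I) * \<bar>(\<Sum>i\<in>I. x i) / real (card I)\<bar> powr \<alpha> \<le> (\<Sum>i\<in>I. \<bar>x i\<bar> powr \<alpha>)"
proof -
  define m where "m = (\<Sum>i\<in>I. x i) / real (card I)"
  define d where "d = \<alpha> * (sgn m * \<bar>m\<bar> powr (\<alpha> - 1))"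
  have "(\<Sum>i\<in>I. x i - m) = 0"
    using assms by (simp add: m_def sum_subtractf)
  then have "real (card I) * \<bar>m\<bar> powr \<alpha> = (\<Sum>i\<in>I. \<bar>m\<bar> powr \<alpha> + d * (x i - m))"
    by (simp add: sum.distrib flip: sum_distrib_left)
  also have "\<dots> \<le> (\<Sum>i\<in>I. \<bar>m + (x i - m)\<bar> powr \<alpha>)"
    unfolding d_def by (intro sum_mono convex_abs_powr_tangent assms)
  finally show ?thesis by (simp add: m_def)
qed

text \<open>Two regimes: if |s| is at most lam |x|^(\<alpha> - 1), the impact cost covers any gain;
  otherwise |x| is at most (|s| / lam)^(1 / (\<alpha> - 1)) and the gain is at most |x| |s|. The
  constant is not optimal; only the power of |s| matters.\<close>

lemma price_impact_conjugate_bound: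
  fixes x s lam \<alpha> :: real
  assumes "\<alpha> > 1" "lam > 0"
  shows "- x * s - lam * \<bar>x\<bar> powr \<alpha> \<le> lam powr (- 1 / (\<alpha> - 1)) * \<bar>s\<bar> powr (1 + 1 / (\<alpha> - 1))"
proof (cases "\<bar>s\<bar> \<le> lam * \<bar>x\<bar> powr (\<alpha> - 1)")
  case True
  have "- x * s \<le> \<bar>x\<bar> * \<bar>s\<bar>"
    by (metis abs_ge_minus_self abs_mult mult_minus_left)
  also have "\<dots> \<le> \<bar>x\<bar> * (lam * \<bar>x\<bar> powr (\<alpha> - 1))"
    using True by (intro mult_left_mono) auto
  also have "\<dots> = lam * \<bar>x\<bar> powr \<alpha>"
    by (simp add: powr_diff)
  finally have "- x * s - lam * \<bar>x\<bar> powr \<alpha> \<le> 0" by simp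
  also have "0 \<le> lam powr (- 1 / (\<alpha> - 1)) * \<bar>s\<bar> powr (1 + 1 / (\<alpha> - 1))"
    by simp
  finally show ?thesis .
next
  case False
  then have s: "\<bar>s\<bar> > 0" using assms
    by (smt (verit) mult_nonneg_nonneg powr_ge_zero)
  have "\<bar>x\<bar> powr (\<alpha> - 1) \<le> \<bar>s\<bar> / lam"
    using False assms by (simp add: field_simps)
  then have "(\<bar>x\<bar> powr (\<alpha> - 1)) powr (1 / (\<alpha> - 1)) \<le> (\<bar>s\<bar> / lam) powr (1 / (\<alpha> - 1))"
    using assms by (intro powr_mono2) auto
  then have x: "\<bar>x\<bar> \<le> (\<bar>s\<bar> / lam) powr (1 / (\<alpha> - 1))"
    using assms by (simp add: powr_powr)
  have "- x * s - lam * \<bar>x\<bar> powr \<alpha> \<le> - x * s"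
    using assms by simp
  also have "\<dots> \<le> \<bar>x\<bar> * \<bar>s\<bar>"
    by (metis abs_ge_minus_self abs_mult mult_minus_left)
  also have "\<dots> \<le> (\<bar>s\<bar> / lam) powr (1 / (\<alpha> - 1)) * \<bar>s\<bar>"
    using x by (intro mult_right_mono) auto
  also have "\<dots> = lam powr (- 1 / (\<alpha> - 1)) * \<bar>s\<bar> powr (1 + 1 / (\<alpha> - 1))"
    using s assms minus_divide_left[of 1 "\<alpha> - 1"]
    by (simp add: powr_divide powr_add powr_minus_divide)
  finally show ?thesis .
qed

section \<open>Absolute moments of Gaussian variables\<close>

definition normal_abs_moment :: "real \<Rightarrow> real" where
  "normal_abs_moment \<beta> = (\<integral>x. std_normal_density x * \<bar>x\<bar> powr \<beta> \<partial>lborel)"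

lemma integrable_std_normal_abs_powr:
  assumes "\<beta> \<ge> 0"
  shows "integrable lborel (\<lambda>x. std_normal_density x * \<bar>x\<bar> powr \<beta>)"
proof (rule Bochner_Integration.integrable_bound)
  define k where "k = nat \<lceil>\<beta>\<rceil>"
  show "integrable lborel (\<lambda>x. std_normal_density x * \<bar>x\<bar> ^ 0 + std_normal_density x * \<bar>x\<bar> ^ k)"
    by (intro Bochner_Integration.integrable_add integrable_std_normal_moment_abs)
  have "\<bar>x\<bar> powr \<beta> \<le> 1 + \<bar>x\<bar> ^ k" for x :: real
  proof (cases "\<bar>x\<bar> \<le> 1")
    case True
    then have "\<bar>x\<bar> powr \<beta> \<le> 1 powr \<beta>"
      using assms by (intro powr_mono2) auto
    then show ?thesis by (smt (verit) powr_one_eq_one zero_le_power abs_ge_zero)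
  next
    case False
    then have "\<bar>x\<bar> powr \<beta> \<le> \<bar>x\<bar> powr real k"
      unfolding k_def by (intro powr_mono) linarith+
    then show ?thesis using False by (simp add: powr_realpow)
  qed
  then show "AE x in lborel. norm (std_normal_density x * \<bar>x\<bar> powr \<beta>)
      \<le> norm (std_normal_density x * \<bar>x\<bar> ^ 0 + std_normal_density x * \<bar>x\<bar> ^ k)"
    by (intro AE_I2) (simp only: norm_mult flip: distrib_left, intro mult_left_mono, auto)
qed simp

lemma normal_abs_moment_pos:
  assumes "\<beta> \<ge> 0"
  shows "normal_abs_moment \<beta> > 0"
proof -
  have "normal_abs_moment \<beta> \<noteq> 0"
  proof
    assume "normal_abs_moment \<beta> = 0"
    then have "AE x in lborel. std_normal_density x * \<bar>x\<bar> powr \<beta> = 0"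
      unfolding normal_abs_moment_def
      by (subst (asm) integral_nonneg_eq_0_iff_AE[OF integrable_std_normal_abs_powr[OF assms]]) auto
    then have "AE x::real in lborel. x = 0"
      by eventually_elim (auto simp: less_imp_neq[OF normal_density_pos, symmetric])
    moreover have "AE x::real in lborel. x \<noteq> 0"
      by (rule AE_lborel_singleton)
    ultimately have "AE x::real in lborel. False"
      by eventually_elim auto
    then show False by (simp add: AE_iff_measurable[OF _ refl])
  qed
  moreover have "normal_abs_moment \<beta> \<ge> 0"
    unfolding normal_abs_moment_def by (intro integral_nonneg_AE) auto
  ultimately show ?thesis by simp
qed

text \<open>A centred point mass is almost everywhere zero, and both sides vanish by
  \<open>0 powr x = 0\<close>; otherwise division by the standard deviation reduces to the standard
  normal law. Degenerate prices such as \<open>S 0\<close> are thus covered as well.\<close>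

lemma (in prob_space) centered_gaussian_abs_moment:
  assumes "gaussian_rv M X" and mean: "expectation X = 0" and "\<beta> > 0"
  shows "integrable M (\<lambda>\<omega>. \<bar>X \<omega>\<bar> powr \<beta>)" (is ?int)
    and "expectation (\<lambda>\<omega>. \<bar>X \<omega>\<bar> powr \<beta>) =
      normal_abs_moment \<beta> * expectation (\<lambda>\<omega>. (X \<omega>)\<^sup>2) powr (\<beta> / 2)" (is ?eq)
    and "integrable M (\<lambda>\<omega>. (X \<omega>)\<^sup>2)" (is ?sq)
proof -
  have [measurable]: "X \<in> borel_measurable M"
    using assms by (auto simp: gaussian_rv_def)
  consider (point) m where "distr M borel X = return borel m"
    | (normal) m \<sigma> where "0 < \<sigma>" "distributed M lborel X (\<lambda>x. ennreal (normal_density m \<sigma> x))"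
    using assms by (auto simp: gaussian_rv_def)
  then have "?int \<and> ?eq \<and> ?sq"
  proof cases
    case point
    have "AE x in distr M borel X. x = m"
      unfolding point by (simp add: AE_return)
    then have *: "AE \<omega> in M. X \<omega> = m"
      by (subst (asm) AE_distr_iff) auto
    then have "expectation X = expectation (\<lambda>_. m)"
      by (intro integral_cong_AE) auto
    then have "m = 0" using mean by (simp add: prob_space)
    with * have 0: "AE \<omega> in M. X \<omega> = 0" by simp
    have i: "integrable M (\<lambda>\<omega>. \<bar>X \<omega>\<bar> powr \<beta>)"
      by (subst integrable_cong_AE[where g = "\<lambda>_. 0"]) (use 0 in auto)
    have i2: "integrable M (\<lambda>\<omega>. (X \<omega>)\<^sup>2)"
      by (subst integrable_cong_AE[where g = "\<lambda>_. 0"]) (use 0 in auto)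
    have "expectation (\<lambda>\<omega>. \<bar>X \<omega>\<bar> powr \<beta>) = 0"
      by (subst integral_cong_AE[where g = "\<lambda>_. 0"]) (use 0 in auto)
    moreover have "expectation (\<lambda>\<omega>. (X \<omega>)\<^sup>2) = 0"
      by (subst integral_cong_AE[where g = "\<lambda>_. 0"]) (use 0 in auto)
    ultimately show ?thesis using i i2 by simp
  next
    case normal
    have "m = 0"
      using normal_distributed_expectation[OF normal] mean by simp
    with normal have D: "distributed M lborel (\<lambda>\<omega>. X \<omega> / \<sigma>) std_normal_density"
      using normal_standard_normal_convert[OF normal(1), of X 0] by simp
    have scale: "\<bar>X \<omega>\<bar> powr \<beta> = \<sigma> powr \<beta> * \<bar>X \<omega> / \<sigma>\<bar> powr \<beta>" for \<omega>
      using normal(1) by (simp add: powr_divide)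
    have scale2: "(X \<omega>)\<^sup>2 = \<sigma>\<^sup>2 * (X \<omega> / \<sigma>)\<^sup>2" for \<omega>
      using normal(1) by (simp add: power_divide)
    have i: "integrable M (\<lambda>\<omega>. \<bar>X \<omega> / \<sigma>\<bar> powr \<beta>)"
      using distributed_integrable[OF D, of "\<lambda>x. \<bar>x\<bar> powr \<beta>"] integrable_std_normal_abs_powr[of \<beta>] assms
      by simp
    have e: "expectation (\<lambda>\<omega>. \<bar>X \<omega> / \<sigma>\<bar> powr \<beta>) = normal_abs_moment \<beta>"
      using distributed_integral[OF D, of "\<lambda>x. \<bar>x\<bar> powr \<beta>"]
      by (simp add: normal_abs_moment_def)
    have i2: "integrable M (\<lambda>\<omega>. (X \<omega> / \<sigma>)\<^sup>2)"
      using distributed_integrable[OF D, of "\<lambda>x. x\<^sup>2"] integrable_std_normal_moment[of 2]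
      by simp
    have e2: "expectation (\<lambda>\<omega>. (X \<omega> / \<sigma>)\<^sup>2) = 1"
      using distributed_integral[OF D, of "\<lambda>x. x\<^sup>2"] integral_std_normal_moment_even[of 1]
      by simp
    have "expectation (\<lambda>\<omega>. (X \<omega>)\<^sup>2) = \<sigma>\<^sup>2"
      unfolding scale2 using e2 by simp
    then have "expectation (\<lambda>\<omega>. (X \<omega>)\<^sup>2) powr (\<beta> / 2) = \<sigma> powr \<beta>"
      using normal(1) powr_powr[of \<sigma> 2 "\<beta> / 2"] by (simp add: powr_numeral)
    moreover have "expectation (\<lambda>\<omega>. \<bar>X \<omega>\<bar> powr \<beta>) = \<sigma> powr \<beta> * normal_abs_moment \<beta>"
      unfolding scale using e by simp
    moreover have "?int" unfolding scale using i by simp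
    moreover have "?sq" unfolding scale2 using i2 by simp
    ultimately show ?thesis by simp
  qed
  then show ?int ?eq ?sq by auto
qed

lemma (in prob_space) integrable_mult_of_squares:
  fixes X Y :: "'a \<Rightarrow> real"
  assumes [measurable]: "X \<in> borel_measurable M" "Y \<in> borel_measurable M"
    and "integrable M (\<lambda>\<omega>. (X \<omega>)\<^sup>2)" "integrable M (\<lambda>\<omega>. (Y \<omega>)\<^sup>2)"
  shows "integrable M (\<lambda>\<omega>. X \<omega> * Y \<omega>)"
proof (rule Bochner_Integration.integrable_bound)
  show "integrable M (\<lambda>\<omega>. (X \<omega>)\<^sup>2 + (Y \<omega>)\<^sup>2)"
    using assms by simp
  have "\<bar>x * y\<bar> \<le> x\<^sup>2 + y\<^sup>2" for x y :: real
  proof -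
    have "2 * \<bar>x * y\<bar> \<le> x\<^sup>2 + y\<^sup>2"
      using sum_squares_bound[of "\<bar>x\<bar>" "\<bar>y\<bar>"] by (simp add: abs_mult)
    then show ?thesis using abs_ge_zero[of "x * y"] by linarith
  qed
  then show "AE \<omega> in M. norm (X \<omega> * Y \<omega>) \<le> norm ((X \<omega>)\<^sup>2 + (Y \<omega>)\<^sup>2)"
    by simp
qed simp

text \<open>The tangent inequality at \<open>X + b Y\<close>, integrated and divided by \<open>b\<close>, bounds the cross moment by a
  difference quotient of \<open>b \<mapsto> E \<bar>X + b Y\<bar>\<^sup>\<beta>\<close>, which only involves one-dimensional laws; then
  \<open>b\<close> tends to \<open>0\<close>.\<close>

lemma (in prob_space) gaussian_power_cross_moment:
  assumes gauss: "\<And>b. gaussian_rv M (\<lambda>\<omega>. X \<omega> + b * Y \<omega>)" "gaussian_rv M Y"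
    and mean: "expectation X = 0" "expectation Y = 0"
    and "\<beta> > 1"
  shows "integrable M (\<lambda>\<omega>. sgn (X \<omega>) * \<bar>X \<omega>\<bar> powr (\<beta> - 1) * Y \<omega>)"
    and "expectation (\<lambda>\<omega>. sgn (X \<omega>) * \<bar>X \<omega>\<bar> powr (\<beta> - 1) * Y \<omega>) \<le>
      normal_abs_moment \<beta> * expectation (\<lambda>\<omega>. (X \<omega>)\<^sup>2) powr (\<beta> / 2 - 1) *
      expectation (\<lambda>\<omega>. X \<omega> * Y \<omega>)"
proof -
  have gX: "gaussian_rv M X"
    using gauss(1)[of 0] by simp
  have [measurable]: "X \<in> borel_measurable M" "Y \<in> borel_measurable M"
    using gX gauss(2) by (auto simp: gaussian_rv_def)
  define g where "g \<omega> = sgn (X \<omega>) * \<bar>X \<omega>\<bar> powr (\<beta> - 1) * Y \<omega>" for \<omega>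
  have [measurable]: "g \<in> borel_measurable M"
    unfolding g_def by measurable
  have pos: "\<beta> > 0" using \<open>\<beta> > 1\<close> by simp
  note mX = centered_gaussian_abs_moment[OF gX mean(1) pos]
  note mY = centered_gaussian_abs_moment[OF gauss(2) mean(2) pos]
  have iXY: "integrable M (\<lambda>\<omega>. X \<omega> * Y \<omega>)"
    by (intro integrable_mult_of_squares mX mY) auto
  have iX: "integrable M X" and iY: "integrable M Y"
    using mX(3) mY(3) by (auto intro: square_integrable_imp_integrable)
  have ig: "integrable M g"
  proof (rule Bochner_Integration.integrable_bound)
    show "integrable M (\<lambda>\<omega>. \<bar>X \<omega>\<bar> powr \<beta> + \<bar>Y \<omega>\<bar> powr \<beta>)"
      using mX(1) mY(1) by simp
    \<comment> \<open>The power of the larger number alone dominates the product, so integrability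
      follows from the absolute moments.\<close>
    have "x powr (\<beta> - 1) * y \<le> x powr \<beta> + y powr \<beta>" if "x \<ge> 0" "y \<ge> 0" for x y :: real
    proof (cases "y \<le> x")
      case True
      then have "x powr (\<beta> - 1) * y \<le> x powr (\<beta> - 1) * x"
        by (intro mult_left_mono) auto
      also have "\<dots> = x powr \<beta>"
        using that by (simp add: powr_diff)
      also have "\<dots> \<le> x powr \<beta> + y powr \<beta>" by simp
      finally show ?thesis .
    next
      case False
      then have "x powr (\<beta> - 1) * y \<le> y powr (\<beta> - 1) * y"
        using that \<open>\<beta> > 1\<close> by (intro mult_right_mono powr_mono2) auto
      also have "\<dots> = y powr \<beta>"
        using that by (simp add: powr_diff)
      also have "\<dots> \<le> x powr \<beta> + y powr \<beta>" by simp
      finally show ?thesis .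
    qed
    then show "AE \<omega> in M. norm (g \<omega>) \<le> norm (\<bar>X \<omega>\<bar> powr \<beta> + \<bar>Y \<omega>\<bar> powr \<beta>)"
      by (intro AE_I2) (auto simp: g_def abs_mult sgn_if)
  qed simp
  then show "integrable M (\<lambda>\<omega>. sgn (X \<omega>) * \<bar>X \<omega>\<bar> powr (\<beta> - 1) * Y \<omega>)"
    by (simp add: g_def[abs_def])
  define v where "v = expectation (\<lambda>\<omega>. (X \<omega>)\<^sup>2)"
  define c where "c = expectation (\<lambda>\<omega>. X \<omega> * Y \<omega>)"
  define w where "w = expectation (\<lambda>\<omega>. (Y \<omega>)\<^sup>2)"
  define \<kappa> where "\<kappa> = normal_abs_moment \<beta>"
  have "v \<ge> 0" unfolding v_def by simp
  have "expectation g \<le> \<kappa> * v powr (\<beta> / 2 - 1) * c"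
  proof (cases "v = 0")
    \<comment> \<open>Here \<open>X\<close> vanishes almost everywhere, and the right-hand side is 0
      because \<open>0 powr x = 0\<close> even for a negative exponent.\<close>
    case True
    then have "AE \<omega> in M. (X \<omega>)\<^sup>2 = 0"
      unfolding v_def by (subst (asm) integral_nonneg_eq_0_iff_AE[OF mX(3)]) auto
    then have "AE \<omega> in M. g \<omega> = 0"
      by eventually_elim (simp add: g_def)
    then have "expectation g = expectation (\<lambda>_. 0)"
      by (intro integral_cong_AE) auto
    then show ?thesis using True by simp
  next
    case False
    with \<open>v \<ge> 0\<close> have "v > 0" by simp
    \<comment> \<open>Up to the factor \<kappa>, \<open>h b\<close> is the absolute moment of
      \<open>X + b * Y\<close>, and \<open>h 0\<close> is that of \<open>X\<close>.\<close>
    define h where "h b = (v + 2 * b * c + b\<^sup>2 * w) powr (\<beta> / 2)" for b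
    have bound: "expectation g \<le> \<kappa> / \<beta> * ((h b - h 0) / b)" if "b > 0" for b
    proof -
      have "(\<lambda>\<omega>. (X \<omega> + b * Y \<omega>)\<^sup>2) = (\<lambda>\<omega>. (X \<omega>)\<^sup>2 + 2 * b * (X \<omega> * Y \<omega>) + b\<^sup>2 * (Y \<omega>)\<^sup>2)"
        by (simp add: fun_eq_iff power2_eq_square algebra_simps)
      then have sq: "expectation (\<lambda>\<omega>. (X \<omega> + b * Y \<omega>)\<^sup>2) = v + 2 * b * c + b\<^sup>2 * w"
        unfolding v_def c_def w_def using mX(3) mY(3) iXY by simp
      have mean_b: "expectation (\<lambda>\<omega>. X \<omega> + b * Y \<omega>) = 0"
        using iX iY mean by simp
      note mb = centered_gaussian_abs_moment[OF gauss(1)[of b] mean_b pos]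
      have "expectation (\<lambda>\<omega>. \<bar>X \<omega>\<bar> powr \<beta> + \<beta> * b * g \<omega>) \<le> expectation (\<lambda>\<omega>. \<bar>X \<omega> + b * Y \<omega>\<bar> powr \<beta>)"
      proof (rule integral_mono)
        show "integrable M (\<lambda>\<omega>. \<bar>X \<omega>\<bar> powr \<beta> + \<beta> * b * g \<omega>)"
          using mX(1) ig by simp
        show "\<bar>X \<omega>\<bar> powr \<beta> + \<beta> * b * g \<omega> \<le> \<bar>X \<omega> + b * Y \<omega>\<bar> powr \<beta>" for \<omega>
          using convex_abs_powr_tangent[OF \<open>\<beta> > 1\<close>, of "X \<omega>" "b * Y \<omega>"]
          by (simp add: g_def mult_ac)
      qed (rule mb(1))
      then have "\<kappa> * v powr (\<beta> / 2) + \<beta> * b * expectation g \<le> \<kappa> * (v + 2 * b * c + b\<^sup>2 * w) powr (\<beta> / 2)"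
        using mX(1,2) mb(2) ig by (simp add: sq \<kappa>_def v_def)
      then have "\<beta> * b * expectation g \<le> \<kappa> * (h b - h 0)"
        by (simp add: h_def algebra_simps)
      then show ?thesis using \<open>b > 0\<close> pos by (simp add: field_simps)
    qed
    \<comment> \<open>Positivity of \<open>v\<close> makes \<open>h\<close> differentiable at 0, so
      the difference quotients from the right converge to this derivative; its factor \<beta>
      cancels the one in the bound.\<close>
    have "(h has_real_derivative (\<beta> / 2 * v powr (\<beta> / 2 - 1) * (2 * c))) (at 0)"
      unfolding h_def using \<open>v > 0\<close>
      by (auto intro!: derivative_eq_intros simp: powr_diff)
    then have "((\<lambda>b. (h b - h 0) / b) \<longlongrightarrow> \<beta> / 2 * v powr (\<beta> / 2 - 1) * (2 * c)) (at_right 0)"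
      by (auto simp: has_field_derivative_iff filterlim_at_split)
    then have "((\<lambda>b. \<kappa> / \<beta> * ((h b - h 0) / b)) \<longlongrightarrow> \<kappa> / \<beta> * (\<beta> / 2 * v powr (\<beta> / 2 - 1) * (2 * c))) (at_right 0)"
      by (rule tendsto_mult_left)
    moreover have "\<forall>\<^sub>F b in at_right 0. expectation g \<le> \<kappa> / \<beta> * ((h b - h 0) / b)"
      using bound by (simp add: eventually_at_right_less eventually_at_filter)
    ultimately have "expectation g \<le> \<kappa> / \<beta> * (\<beta> / 2 * v powr (\<beta> / 2 - 1) * (2 * c))"
      by (rule tendsto_lowerbound) simp
    then show ?thesis using pos by simp
  qed
  then show "expectation (\<lambda>\<omega>. sgn (X \<omega>) * \<bar>X \<omega>\<bar> powr (\<beta> - 1) * Y \<omega>) \<le>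
      normal_abs_moment \<beta> * expectation (\<lambda>\<omega>. (X \<omega>)\<^sup>2) powr (\<beta> / 2 - 1) *
      expectation (\<lambda>\<omega>. X \<omega> * Y \<omega>)"
    by (simp add: g_def[abs_def] \<kappa>_def v_def c_def)
qed

section \<open>Partial sums of anti-persistent sequences\<close>

lemma powr_increment:
  fixes x e :: real
  assumes "x > 0"
  obtains z where "x < z" "z < x + 1" "(x + 1) powr e - x powr e = e * z powr (e - 1)"
proof -
  have "\<exists>z>x. z < x + 1 \<and> (x + 1) powr e - x powr e = (x + 1 - x) * (e * z powr (e - 1))"
    using assms by (intro MVT2) (auto intro!: derivative_eq_intros simp: powr_diff)
  then show ?thesis using that by auto
qed

lemma filterlim_nat_powr_at_top:
  assumes "p > 0"
  shows "filterlim (\<lambda>n. real n powr p) at_top sequentially"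
proof (subst filterlim_at_top_iff_inverse_0)
  show "\<forall>\<^sub>F n in sequentially. 0 < real n powr p"
    using eventually_gt_at_top[of 0] by eventually_elim simp
  have "(\<lambda>n. real n powr - p) \<longlonglongrightarrow> 0"
    using assms by (intro tendsto_neg_powr filterlim_real_sequentially) auto
  then show "((inverse \<circ> (\<lambda>n. real n powr p)) \<longlongrightarrow> 0) sequentially"
    by (simp add: powr_minus comp_def)
qed

text \<open>For the partial sums \<open>S\<close> of a stationary sequence with autocovariance \<open>\<rho>\<close>, the next three
  quantities are \<open>var(S\<^sub>u\<^sub>+\<^sub>1) - var(S\<^sub>u)\<close>, \<open>var(S\<^sub>t)\<close> and
  \<open>cov(S\<^sub>s, S\<^sub>s\<^sub>+\<^sub>d - S\<^sub>s)\<close>.\<close>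

definition variance_increment :: "(nat \<Rightarrow> real) \<Rightarrow> nat \<Rightarrow> real" where
  "variance_increment \<rho> u = \<rho> 0 + 2 * (\<Sum>m<u. \<rho> (Suc m))"

definition walk_variance :: "(nat \<Rightarrow> real) \<Rightarrow> nat \<Rightarrow> real" where
  "walk_variance \<rho> t = (\<Sum>u<t. variance_increment \<rho> u)"

definition increment_cov :: "(nat \<Rightarrow> real) \<Rightarrow> nat \<Rightarrow> nat \<Rightarrow> real" where
  "increment_cov \<rho> s d = (\<Sum>u<s. \<Sum>m<d. \<rho> (u + Suc m))"

text \<open>The deterministic content of the problem. \<open>increment_tendsto_0\<close> expresses
  that the total sum is zero, because \<open>variance_increment \<rho> n\<close> is the sum of the
  even extension of \<rho> over the lags from -n to n.\<close>

locale anti_persistent_covariance =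
  fixes \<rho> :: "nat \<Rightarrow> real" and N :: nat and J\<^sub>1 J\<^sub>2 chi :: real
  assumes N_pos: "N \<ge> 1"
    and J_neg: "J\<^sub>1 < 0" "J\<^sub>2 < 0"
    and chi: "-2 < chi" "chi < -1"
    and \<rho>_lower: "\<And>k. k \<ge> N \<Longrightarrow> J\<^sub>1 * real k powr chi \<le> \<rho> k"
    and \<rho>_upper: "\<And>k. k \<ge> N \<Longrightarrow> \<rho> k \<le> J\<^sub>2 * real k powr chi"
    and increment_tendsto_0: "variance_increment \<rho> \<longlonglongrightarrow> 0"
begin

lemma \<rho>_nonpos: "k \<ge> N \<Longrightarrow> \<rho> k \<le> 0"
  using \<rho>_upper[of k] J_neg by (smt (verit) mult_nonpos_nonneg powr_ge_zero)

lemma increment_Suc: "variance_increment \<rho> (Suc u) = variance_increment \<rho> u + 2 * \<rho> (Suc u)"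
  by (simp add: variance_increment_def)

text \<open>As the total sum is zero, the increment is minus twice the tail of \<rho> beyond
  \<open>u\<close>, and the lower bound on \<rho> compares this tail with an integral of x^chi. The
  constant is positive, being a quotient of negative numbers.\<close>

lemma increment_upper:
  assumes "u \<ge> N"
  shows "variance_increment \<rho> u \<le> 2 * J\<^sub>1 / (chi + 1) * real u powr (chi + 1)"
proof -
  \<comment> \<open>\<open>F\<close> increases to its limit \<open>0\<close>\<close>
  define F where "F u = variance_increment \<rho> u - 2 * J\<^sub>1 / (chi + 1) * real u powr (chi + 1)" for u
  have step: "F u \<le> F (Suc u)" if "u \<ge> N" for u
  proof -
    have u: "real u > 0" using that N_pos by simp
    obtain z where z: "real u < z" "z < real u + 1"
      "(real u + 1) powr (chi + 1) - real u powr (chi + 1) = (chi + 1) * z powr (chi + 1 - 1)"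
      using powr_increment[OF u] .
    have "real (Suc u) powr chi \<le> z powr chi"
      using z u chi by (intro powr_mono2') auto
    then have "J\<^sub>1 * z powr chi \<le> J\<^sub>1 * real (Suc u) powr chi"
      using J_neg by (intro mult_left_mono_neg) auto
    also have "\<dots> \<le> \<rho> (Suc u)"
      using that by (intro \<rho>_lower) simp
    finally have "J\<^sub>1 * z powr chi \<le> \<rho> (Suc u)" .
    moreover have "F (Suc u) - F u = 2 * \<rho> (Suc u) - 2 * J\<^sub>1 / (chi + 1) *
        ((real u + 1) powr (chi + 1) - real u powr (chi + 1))"
      by (simp add: F_def increment_Suc algebra_simps)
    moreover have "\<dots> = 2 * \<rho> (Suc u) - 2 * (J\<^sub>1 * z powr chi)"
      unfolding z(3) using chi by simp
    ultimately show ?thesis by simp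
  qed
  have "(\<lambda>u. real u powr (chi + 1)) \<longlonglongrightarrow> 0"
    using chi by (intro tendsto_neg_powr filterlim_real_sequentially) auto
  then have "F \<longlonglongrightarrow> 0 - 2 * J\<^sub>1 / (chi + 1) * 0"
    unfolding F_def by (intro tendsto_intros increment_tendsto_0)
  then have "(\<lambda>k. F (k + u)) \<longlonglongrightarrow> 0"
    by (simp add: LIMSEQ_ignore_initial_segment)
  moreover have "incseq (\<lambda>k. F (k + u))"
    using step assms by (intro incseq_SucI) simp
  ultimately have "F (0 + u) \<le> 0"
    by (intro incseq_le)
  then show ?thesis by (simp add: F_def)
qed

lemma increment_antimono:
  assumes "u \<ge> N" "u \<le> l"
  shows "variance_increment \<rho> l \<le> variance_increment \<rho> u"
  using assms(2,1)
proof (induction rule: dec_induct)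
  case (step n)
  then show ?case using \<rho>_nonpos[of "Suc n"] by (simp add: increment_Suc)
qed simp

lemma increment_nonneg:
  assumes "u \<ge> N"
  shows "variance_increment \<rho> u \<ge> 0"
proof -
  have "decseq (\<lambda>k. variance_increment \<rho> (k + u))"
    using assms by (intro decseq_SucI increment_antimono) auto
  moreover have "(\<lambda>k. variance_increment \<rho> (k + u)) \<longlonglongrightarrow> 0"
    using increment_tendsto_0 by (rule LIMSEQ_ignore_initial_segment)
  ultimately have "0 \<le> variance_increment \<rho> (0 + u)"
    by (intro decseq_ge)
  then show ?thesis by simp
qed

text \<open>The increment is still nonnegative at \<open>2 * u\<close>, so at \<open>u\<close> it
  must make up for the drop caused by the \<open>u\<close> lags in between, each with covariance at
  most \<open>J\<^sub>2 * (2 * u) powr chi\<close>.\<close>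

lemma increment_lower:
  assumes "u \<ge> N"
  shows "- 2 * J\<^sub>2 * 2 powr chi * real u powr (chi + 1) \<le> variance_increment \<rho> u"
proof -
  have u: "real u > 0" using assms N_pos by simp
  have "variance_increment \<rho> (u + d) = variance_increment \<rho> u + 2 * (\<Sum>m<d. \<rho> (Suc (u + m)))" for d
    by (induction d) (simp_all add: increment_Suc)
  then have "0 \<le> variance_increment \<rho> u + 2 * (\<Sum>m<u. \<rho> (Suc (u + m)))"
    using increment_nonneg[of "u + u"] assms by simp
  also have "(\<Sum>m<u. \<rho> (Suc (u + m))) \<le> (\<Sum>m<u. J\<^sub>2 * (2 * real u) powr chi)"
  proof (rule sum_mono)
    fix m assume m: "m \<in> {..<u}"
    have "\<rho> (Suc (u + m)) \<le> J\<^sub>2 * real (Suc (u + m)) powr chi"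
      using assms by (intro \<rho>_upper) simp
    also have "\<dots> \<le> J\<^sub>2 * (2 * real u) powr chi"
      using m chi J_neg by (intro mult_left_mono_neg powr_mono2') auto
    finally show "\<rho> (Suc (u + m)) \<le> J\<^sub>2 * (2 * real u) powr chi" .
  qed
  also have "(\<Sum>m<u. J\<^sub>2 * (2 * real u) powr chi) = J\<^sub>2 * 2 powr chi * real u powr (chi + 1)"
    using u by (simp add: powr_mult powr_add)
  finally show ?thesis by simp
qed

text \<open>By induction from \<open>N\<close> on: an increment of order t^(chi + 1) is compared,
  through the mean value theorem, with the difference of x^(chi + 2) between t and t + 1.\<close>

lemma walk_variance_upper:
  obtains C where "C > 0" "\<And>t. t \<ge> 1 \<Longrightarrow> walk_variance \<rho> t \<le> C * real t powr (chi + 2)"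
proof -
  define A where "A = 2 * J\<^sub>1 / (chi + 1)"
  have "A > 0" unfolding A_def using J_neg chi by (intro divide_neg_neg) auto
  \<comment> \<open>The first summand makes the induction step work, the factor
    \<open>2 powr (chi + 1)\<close> coming from z \<le> 2 t; the second covers the finitely many
    times up to \<open>N\<close>.\<close>
  define C where "C = A / ((chi + 2) * 2 powr (chi + 1)) + (\<Sum>t\<le>N. \<bar>walk_variance \<rho> t\<bar>)"
  have C1: "A / ((chi + 2) * 2 powr (chi + 1)) \<le> C" and C2: "(\<Sum>t\<le>N. \<bar>walk_variance \<rho> t\<bar>) \<le> C"
    unfolding C_def using \<open>A > 0\<close> chi by (auto intro!: sum_nonneg)
  have "A / ((chi + 2) * 2 powr (chi + 1)) > 0"
    using \<open>A > 0\<close> chi by simp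
  with C1 have "C > 0" by simp
  have small: "walk_variance \<rho> t \<le> C * real t powr (chi + 2)" if "1 \<le> t" "t \<le> N" for t
  proof -
    have "walk_variance \<rho> t \<le> \<bar>walk_variance \<rho> t\<bar>" by simp
    also have "\<dots> \<le> (\<Sum>t\<le>N. \<bar>walk_variance \<rho> t\<bar>)"
      using that by (intro member_le_sum) auto
    also have "\<dots> \<le> C * 1" using C2 by simp
    also have "\<dots> \<le> C * real t powr (chi + 2)"
      using \<open>C > 0\<close> that chi by (intro mult_left_mono ge_one_powr_ge_zero) auto
    finally show ?thesis .
  qed
  have large: "walk_variance \<rho> t \<le> C * real t powr (chi + 2)" if "N \<le> t" for t
    using that
  proof (induction rule: dec_induct)
    case base
    then show ?case using small N_pos by simp
  next
    case (step t)
    have t: "real t \<ge> 1" using step N_pos by simp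
    obtain z where z: "real t < z" "z < real t + 1"
      "(real t + 1) powr (chi + 2) - real t powr (chi + 2) = (chi + 2) * z powr (chi + 2 - 1)"
      by (rule powr_increment[of "real t" "chi + 2"]) (use t in auto)
    have "2 powr (chi + 1) * real t powr (chi + 1) = (2 * real t) powr (chi + 1)"
      by (simp add: powr_mult)
    also have "\<dots> \<le> z powr (chi + 1)"
      using z t chi by (intro powr_mono2') auto
    finally have "2 powr (chi + 1) * real t powr (chi + 1) \<le> z powr (chi + 1)" .
    then have "A / ((chi + 2) * 2 powr (chi + 1)) * (chi + 2) * (2 powr (chi + 1) * real t powr (chi + 1))
        \<le> A / ((chi + 2) * 2 powr (chi + 1)) * (chi + 2) * z powr (chi + 1)"
      using \<open>A > 0\<close> chi by (intro mult_left_mono) auto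
    also have "\<dots> \<le> C * (chi + 2) * z powr (chi + 1)"
      using C1 chi by (intro mult_right_mono) auto
    finally have "A * real t powr (chi + 1) \<le> C * ((chi + 2) * z powr (chi + 1))"
      using chi by simp
    moreover have "variance_increment \<rho> t \<le> A * real t powr (chi + 1)"
      unfolding A_def using step by (intro increment_upper) simp
    ultimately have "variance_increment \<rho> t \<le> C * ((real t + 1) powr (chi + 2) - real t powr (chi + 2))"
      unfolding z(3) by (simp add: add.commute)
    then show ?case
      using step.IH by (simp add: walk_variance_def algebra_simps)
  qed
  show ?thesis
    using that[of C] \<open>C > 0\<close> small large by (metis nat_le_linear)
qed

text \<open>For t \<ge> 2 N at least t / 2 indices lie between \<open>N\<close> and t, each with an
  increment of order at least t^(chi + 1).\<close>

lemma walk_variance_lower: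
  obtains c t\<^sub>0 where "c > 0" "t\<^sub>0 \<ge> 1" "\<And>t. t \<ge> t\<^sub>0 \<Longrightarrow> c * real t powr (chi + 2) \<le> walk_variance \<rho> t"
proof -
  define c where "c = - J\<^sub>2 * 2 powr chi"
  have "c > 0" unfolding c_def using J_neg by (simp add: mult_neg_pos)
  have "filterlim (\<lambda>t. real t powr (chi + 2)) at_top sequentially"
    using chi by (intro filterlim_nat_powr_at_top) auto
  \<comment> \<open>Beyond this threshold half of the main term absorbs the contribution of the
    indices below \<open>N\<close>, whatever its sign.\<close>
  then have "\<forall>\<^sub>F t in sequentially. real t powr (chi + 2) \<ge> 2 * \<bar>walk_variance \<rho> N\<bar> / c"
    by (simp add: filterlim_at_top)
  then obtain t1 where t1: "\<And>t. t \<ge> t1 \<Longrightarrow> real t powr (chi + 2) \<ge> 2 * \<bar>walk_variance \<rho> N\<bar> / c"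
    by (auto simp: eventually_sequentially)
  have lower: "c / 2 * real t powr (chi + 2) \<le> walk_variance \<rho> t" if "t \<ge> max t1 (2 * N)" for t
  proof -
    have t: "real t > 0" "t \<ge> N" "real t \<ge> 2 * real N" using that N_pos by auto
    have "walk_variance \<rho> t = walk_variance \<rho> N + (\<Sum>u\<in>{N..<t}. variance_increment \<rho> u)"
      unfolding walk_variance_def lessThan_atLeast0 using t
      by (intro sum.atLeastLessThan_concat[symmetric]) auto
    moreover have "(\<Sum>u\<in>{N..<t}. 2 * c * real t powr (chi + 1)) \<le> (\<Sum>u\<in>{N..<t}. variance_increment \<rho> u)"
    proof (rule sum_mono)
      fix u assume u: "u \<in> {N..<t}"
      have "2 * c * real t powr (chi + 1) \<le> 2 * c * real u powr (chi + 1)"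
        using u \<open>c > 0\<close> N_pos chi by (intro mult_left_mono powr_mono2') auto
      also have "\<dots> \<le> variance_increment \<rho> u"
        using increment_lower[of u] u by (simp add: c_def)
      finally show "2 * c * real t powr (chi + 1) \<le> variance_increment \<rho> u" .
    qed
    moreover have "c * real t powr (chi + 2) \<le> (\<Sum>u\<in>{N..<t}. 2 * c * real t powr (chi + 1))"
    proof -
      have "c * real t powr (chi + 2) = real t / 2 * (2 * c * real t powr (chi + 1))"
        using t by (simp add: powr_add power2_eq_square)
      also have "\<dots> \<le> real (t - N) * (2 * c * real t powr (chi + 1))"
        using t \<open>c > 0\<close> by (intro mult_right_mono) auto
      finally show ?thesis by simp
    qed
    moreover have "- walk_variance \<rho> N \<le> c / 2 * real t powr (chi + 2)"
      using t1[of t] that \<open>c > 0\<close> by (simp add: field_simps)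
    ultimately show ?thesis by simp
  qed
  show ?thesis
    using that[of "c / 2" "max t1 (2 * N)"] \<open>c > 0\<close> lower N_pos by simp
qed

text \<open>Only lags below \<open>N\<close> can contribute positively, and they occur only if u <
  N.\<close>

lemma inner_sum_le: "(\<Sum>m<d. \<rho> (u + Suc m)) \<le> (if u < N then \<Sum>k<N. \<bar>\<rho> k\<bar> else 0)"
proof (cases "u < N")
  case True
  have "(\<Sum>m<d. \<rho> (u + Suc m)) \<le> (\<Sum>m<d. if u + Suc m < N then \<bar>\<rho> (u + Suc m)\<bar> else 0)"
    using \<rho>_nonpos by (intro sum_mono) (auto simp: not_less)
  also have "\<dots> = (\<Sum>m\<in>{m. m < d \<and> u + Suc m < N}. \<bar>\<rho> (u + Suc m)\<bar>)"
    by (simp add: sum.If_cases Int_def)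
  also have "\<dots> = (\<Sum>k\<in>(\<lambda>m. u + Suc m) ` {m. m < d \<and> u + Suc m < N}. \<bar>\<rho> k\<bar>)"
    by (subst sum.reindex) (auto simp: inj_on_def)
  also have "\<dots> \<le> (\<Sum>k<N. \<bar>\<rho> k\<bar>)"
    by (intro sum_mono2) auto
  finally show ?thesis using True by simp
next
  case False
  then show ?thesis using \<rho>_nonpos by (auto intro!: sum_nonpos)
qed

lemma increment_cov_bounds:
  obtains c C where "c > 0" "C \<ge> 0" "\<And>s d. increment_cov \<rho> s d \<le> C"
    "\<And>k s d. \<lbrakk>2 * N \<le> k; k \<le> s; k \<le> d; s + d \<le> 6 * k\<rbrakk> \<Longrightarrow>
      increment_cov \<rho> s d \<le> C - c * real k powr (chi + 2)"
proof -
  define B where "B = (\<Sum>k<N. \<bar>\<rho> k\<bar>)"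
  have "B \<ge> 0" unfolding B_def by (intro sum_nonneg) auto
  \<comment> \<open>\<open>C\<close> collects everything positive: at most \<open>N\<close> rows
    \<open>u\<close>, each contributing at most \<open>B\<close>.\<close>
  define C where "C = real N * B"
  have "C \<ge> 0" unfolding C_def using \<open>B \<ge> 0\<close> by simp
  \<comment> \<open>Since s \<ge> k \<ge> 2 N, at least k / 2 rows \<open>u\<close> lie between
    \<open>N\<close> and \<open>s\<close>, each with d \<ge> k lags of size at most 6 k. Every
    covariance there is at most \<open>J\<^sub>2 * (6 * k) powr chi\<close>; the product of these
    three quantities gives \<open>c\<close>.\<close>
  define c where "c = - J\<^sub>2 * 6 powr chi / 2"
  have "c > 0" unfolding c_def using J_neg by (simp add: mult_neg_pos)
  have upto: "(\<Sum>u<s. if u < N then B else 0) \<le> C" for s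
  proof -
    have "(\<Sum>u<s. if u < N then B else 0) = (\<Sum>u\<in>{u. u < s \<and> u < N}. B)"
      by (simp add: sum.If_cases Int_def)
    also have "\<dots> \<le> (\<Sum>u<N. B)"
      using \<open>B \<ge> 0\<close> by (intro sum_mono2) auto
    finally show ?thesis by (simp add: C_def)
  qed
  have all: "increment_cov \<rho> s d \<le> C" for s d
    unfolding increment_cov_def B_def
    by (rule order_trans[OF sum_mono[OF inner_sum_le] upto[unfolded B_def]])
  have strong: "increment_cov \<rho> s d \<le> C - c * real k powr (chi + 2)"
    if k: "2 * N \<le> k" "k \<le> s" "k \<le> d" "s + d \<le> 6 * k" for k s d
  proof -
    have kpos: "real k > 0" using k N_pos by simp
    define q where "q = real k * (J\<^sub>2 * (6 * real k) powr chi)"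
    have "q \<le> 0" unfolding q_def using J_neg by (intro mult_nonneg_nonpos mult_nonpos_nonneg) auto
    have inner: "(\<Sum>m<d. \<rho> (u + Suc m)) \<le> q" if u: "N \<le> u" "u < s" for u
    proof -
      have "(\<Sum>m<d. \<rho> (u + Suc m)) \<le> (\<Sum>m<d. J\<^sub>2 * (6 * real k) powr chi)"
      proof (rule sum_mono)
        fix m assume m: "m \<in> {..<d}"
        then have le: "u + Suc m \<le> 6 * k" using u k by simp
        have "\<rho> (u + Suc m) \<le> J\<^sub>2 * real (u + Suc m) powr chi"
          using u by (intro \<rho>_upper) simp
        also have "\<dots> \<le> J\<^sub>2 * (6 * real k) powr chi"
          using le chi J_neg by (intro mult_left_mono_neg powr_mono2') auto
        finally show "\<rho> (u + Suc m) \<le> J\<^sub>2 * (6 * real k) powr chi" .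
      qed
      also have "\<dots> = real d * (J\<^sub>2 * (6 * real k) powr chi)" by simp
      also have "\<dots> \<le> q"
        unfolding q_def using k J_neg by (intro mult_right_mono_neg mult_nonpos_nonneg) auto
      finally show ?thesis .
    qed
    have "increment_cov \<rho> s d \<le> (\<Sum>u<s. (if u < N then B else 0) + (if N \<le> u then q else 0))"
      unfolding increment_cov_def
    proof (rule sum_mono)
      fix u assume "u \<in> {..<s}"
      then show "(\<Sum>m<d. \<rho> (u + Suc m)) \<le> (if u < N then B else 0) + (if N \<le> u then q else 0)"
        using inner[of u] inner_sum_le[where u = u and d = d] by (auto simp: B_def)
    qed
    also have "\<dots> \<le> C + (\<Sum>u<s. if N \<le> u then q else 0)"
      using upto[of s] by (simp add: sum.distrib)
    also have "(\<Sum>u<s. if N \<le> u then q else 0) = (\<Sum>u\<in>{N..<s}. q)"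
      by (intro sum.mono_neutral_cong_right) auto
    also have "\<dots> = real (s - N) * q" by simp
    also have "\<dots> \<le> real k / 2 * q"
      using k \<open>q \<le> 0\<close> by (intro mult_right_mono_neg) auto
    also have "\<dots> = - c * real k powr (chi + 2)"
      using kpos by (simp add: q_def c_def powr_mult powr_add power2_eq_square)
    finally show ?thesis by simp
  qed
  show ?thesis using that \<open>c > 0\<close> \<open>C \<ge> 0\<close> all strong .
qed

end

section \<open>Second moments of the price\<close>

locale stationary_gaussian_noise = prob_space M for M :: "'a measure" +
  fixes Z :: "int \<Rightarrow> 'a \<Rightarrow> real" and r :: "int \<Rightarrow> real"
  assumes gaussian: "gaussian_process M Z"
    and stationary: "stationary_process M Z"
    and mean_0: "expectation (Z t) = 0"
    and cov: "r t = cov M (Z 0) (Z t)"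
begin

abbreviation S :: "nat \<Rightarrow> 'a \<Rightarrow> real" where "S \<equiv> price Z"

abbreviation \<rho> :: "nat \<Rightarrow> real" where "\<rho> k \<equiv> r (int k)"

lemma Z_measurable [measurable]: "Z j \<in> borel_measurable M"
  using gaussian by (simp add: gaussian_process_def)

lemma gaussian_sum: "finite J \<Longrightarrow> gaussian_rv M (\<lambda>\<omega>. \<Sum>j\<in>J. c j * Z j \<omega>)"
  using gaussian by (auto simp: gaussian_process_def)

lemma Z_square_integrable: "integrable M (\<lambda>\<omega>. (Z j \<omega>)\<^sup>2)"
  using centered_gaussian_abs_moment(3)[of "Z j" 1] gaussian_sum[of "{j}" "\<lambda>_. 1"] mean_0 by simp

lemma Z_integrable: "integrable M (Z j)"
  using Z_square_integrable by (auto intro: square_integrable_imp_integrable)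

lemma price_eq_sum: "S t \<omega> = (\<Sum>j\<in>{1..int t}. Z j \<omega>)"
proof (induction t)
  case (Suc t)
  have "{1..int (Suc t)} = insert (int (Suc t)) {1..int t}" by auto
  with Suc show ?case by simp
qed simp

lemma S_measurable [measurable]: "S t \<in> borel_measurable M"
  unfolding price_eq_sum[abs_def] by measurable

lemma S_mean: "expectation (S t) = 0"
  unfolding price_eq_sum[abs_def] using Z_integrable mean_0 by simp

lemma S_combination_gaussian: "gaussian_rv M (\<lambda>\<omega>. a * S s \<omega> + b * S t \<omega>)"
proof -
  \<comment> \<open>Both prices are written over a common index set with coefficients 0 and 1, so
    their combination is a single finite linear combination of the noise.\<close>
  have ext: "S u \<omega> = (\<Sum>j\<in>{1..int (max s t)}. (if j \<le> int u then 1 else 0) * Z j \<omega>)"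
    if "u \<le> max s t" for u \<omega>
    unfolding price_eq_sum using that by (intro sum.mono_neutral_cong_left) auto
  have "a * S s \<omega> + b * S t \<omega> = (\<Sum>j\<in>{1..int (max s t)}.
      (a * (if j \<le> int s then 1 else 0) + b * (if j \<le> int t then 1 else 0)) * Z j \<omega>)" for \<omega>
    using ext[of s \<omega>] ext[of t \<omega>]
    by (simp only: max.cobounded1 max.cobounded2 distrib_right sum.distrib sum_distrib_left mult.assoc)
  then show ?thesis by (simp only:) (intro gaussian_sum, simp)
qed

lemma S_gaussian: "gaussian_rv M (S t)"
  using S_combination_gaussian[of 1 t 0 t] by simp

lemma S_square_integrable: "integrable M (\<lambda>\<omega>. (S t \<omega>)\<^sup>2)"
  using centered_gaussian_abs_moment(3)[OF S_gaussian S_mean, of 1] by simp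

lemma product_integrable:
  "integrable M (\<lambda>\<omega>. S s \<omega> * S t \<omega>)" "integrable M (\<lambda>\<omega>. S s \<omega> * Z j \<omega>)"
  by (intro integrable_mult_of_squares S_square_integrable Z_square_integrable; simp)+

text \<open>Stationarity, applied to the times 0 and j - i shifted by i, transports the joint law
  and with it the expectation of the coordinate product \<open>g\<close>. For i = j the set
  \<open>J\<close> collapses to one point and the argument is unchanged.\<close>

lemma Z_product_expectation: "expectation (\<lambda>\<omega>. Z i \<omega> * Z j \<omega>) = r (j - i)"
proof -
  define J where "J = {0, j - i}"
  define P where "P = (\<Pi>\<^sub>M j\<in>J. (borel :: real measure))"
  define g where "g f = f 0 * f (j - i)" for f :: "int \<Rightarrow> real"
  have [measurable]: "(\<lambda>\<omega>. \<lambda>j\<in>J. Z (j + h) \<omega>) \<in> M \<rightarrow>\<^sub>M P" for h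
    unfolding P_def by (intro measurable_restrict) simp
  have [measurable]: "g \<in> borel_measurable P"
    unfolding g_def[abs_def] P_def J_def
    by (intro borel_measurable_times measurable_component_singleton) auto
  have "distr M P (\<lambda>\<omega>. \<lambda>j\<in>J. Z (j + i) \<omega>) = distr M P (\<lambda>\<omega>. \<lambda>j\<in>J. Z (j + 0) \<omega>)"
    using stationary by (simp add: stationary_process_def P_def J_def)
  then have "(\<integral>f. g f \<partial>distr M P (\<lambda>\<omega>. \<lambda>j\<in>J. Z (j + i) \<omega>)) = (\<integral>f. g f \<partial>distr M P (\<lambda>\<omega>. \<lambda>j\<in>J. Z (j + 0) \<omega>))"
    by simp
  then have "expectation (\<lambda>\<omega>. g (\<lambda>j\<in>J. Z (j + i) \<omega>)) = expectation (\<lambda>\<omega>. g (\<lambda>j\<in>J. Z (j + 0) \<omega>))"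
    by (subst (asm) (1 2) integral_distr) measurable
  then show ?thesis
    by (simp add: g_def J_def cov cov_def mean_0)
qed

lemma r_even: "r (- t) = r t"
  using Z_product_expectation[of 0 t] Z_product_expectation[of t 0] by (simp add: mult.commute)

lemma S_Z_expectation: "expectation (\<lambda>\<omega>. S s \<omega> * Z (int (s + m)) \<omega>) = (\<Sum>u<s. \<rho> (u + m))"
\<comment> \<open>The offset must vary: once the last summand of \<open>S (Suc s)\<close> is
  removed, the same noise variable lies one step further ahead of \<open>S s\<close>.\<close>
proof (induction s arbitrary: m)
  case (Suc s)
  have "expectation (\<lambda>\<omega>. S (Suc s) \<omega> * Z (int (Suc s + m)) \<omega>) =
      expectation (\<lambda>\<omega>. S s \<omega> * Z (int (s + Suc m)) \<omega> + Z (int (Suc s)) \<omega> * Z (int (s + Suc m)) \<omega>)"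
    by (simp add: distrib_right add_ac)
  also have "\<dots> = (\<Sum>u<s. \<rho> (u + Suc m)) + r (int (s + Suc m) - int (Suc s))"
    using Suc.IH[of "Suc m"] integrable_mult_of_squares[OF _ _ Z_square_integrable Z_square_integrable]
    by (subst Bochner_Integration.integral_add) (auto simp: product_integrable Z_product_expectation simp del: of_nat_Suc of_nat_add)
  also have "\<dots> = (\<Sum>u<Suc s. \<rho> (u + m))"
    by (simp add: sum.lessThan_Suc_shift add.assoc del: sum.lessThan_Suc)
  finally show ?case .
qed simp

lemma S_variance: "expectation (\<lambda>\<omega>. (S s \<omega>)\<^sup>2) = walk_variance \<rho> s"
proof (induction s)
  case (Suc s)
  have "expectation (\<lambda>\<omega>. (S (Suc s) \<omega>)\<^sup>2) =
      expectation (\<lambda>\<omega>. (S s \<omega>)\<^sup>2 + 2 * (S s \<omega> * Z (int (s + 1)) \<omega>) + Z (int (Suc s)) \<omega> * Z (int (Suc s)) \<omega>)"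
    by (simp add: power2_eq_square algebra_simps)
  also have "\<dots> = expectation (\<lambda>\<omega>. (S s \<omega>)\<^sup>2) + 2 * expectation (\<lambda>\<omega>. S s \<omega> * Z (int (s + 1)) \<omega>) +
      expectation (\<lambda>\<omega>. Z (int (Suc s)) \<omega> * Z (int (Suc s)) \<omega>)"
    using product_integrable S_square_integrable
      integrable_mult_of_squares[OF _ _ Z_square_integrable Z_square_integrable]
    by (subst Bochner_Integration.integral_add; (subst Bochner_Integration.integral_add)?) auto
  also have "\<dots> = walk_variance \<rho> (Suc s)"
    unfolding Suc.IH S_Z_expectation Z_product_expectation
    by (simp add: walk_variance_def variance_increment_def)
  finally show ?case .
qed (simp add: walk_variance_def)

lemma S_product_expectation:
  "expectation (\<lambda>\<omega>. S s \<omega> * S (s + d) \<omega>) = walk_variance \<rho> s + increment_cov \<rho> s d"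
proof (induction d)
  case 0
  then show ?case using S_variance[of s] by (simp add: power2_eq_square increment_cov_def)
next
  case (Suc d)
  have "expectation (\<lambda>\<omega>. S s \<omega> * S (s + Suc d) \<omega>) =
      expectation (\<lambda>\<omega>. S s \<omega> * S (s + d) \<omega> + S s \<omega> * Z (int (s + Suc d)) \<omega>)"
    by (simp add: distrib_left)
  also have "\<dots> = walk_variance \<rho> s + increment_cov \<rho> s d + (\<Sum>u<s. \<rho> (u + Suc d))"
    using product_integrable Suc.IH S_Z_expectation[of s "Suc d"]
    by (subst Bochner_Integration.integral_add) auto
  finally show ?case
    by (simp add: increment_cov_def sum.distrib)
qed

text \<open>Unconditional summability gives convergence along symmetric intervals, and evenness of
  \<open>r\<close> folds each symmetric sum into \<open>variance_increment\<close>.\<close>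

lemma variance_increment_tendsto_0:
  assumes "(r has_sum 0) UNIV"
  shows "variance_increment \<rho> \<longlonglongrightarrow> 0"
proof -
  have "filterlim (\<lambda>n. {- int n..int n}) (finite_subsets_at_top UNIV) sequentially"
    unfolding filterlim_iff
  proof (intro allI impI)
    fix P :: "int set \<Rightarrow> bool" assume "eventually P (finite_subsets_at_top UNIV)"
    then obtain F where F: "finite F" "\<And>Y. \<lbrakk>finite Y; F \<subseteq> Y\<rbrakk> \<Longrightarrow> P Y"
      by (auto simp: eventually_finite_subsets_at_top)
    define n\<^sub>0 where "n\<^sub>0 = nat (\<Sum>x\<in>F. \<bar>x\<bar>)"
    have "F \<subseteq> {- int n..int n}" if "n \<ge> n\<^sub>0" for n
    proof
      fix x assume "x \<in> F"
      then have "\<bar>x\<bar> \<le> (\<Sum>x\<in>F. \<bar>x\<bar>)"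
        using F by (intro member_le_sum) auto
      then show "x \<in> {- int n..int n}" using that by (auto simp: n\<^sub>0_def)
    qed
    then show "\<forall>\<^sub>F n in sequentially. P {- int n..int n}"
      using F by (intro eventually_sequentiallyI[of n\<^sub>0]) simp
  qed
  with assms have "(\<lambda>n. sum r {- int n..int n}) \<longlonglongrightarrow> 0"
    unfolding has_sum_def by (rule filterlim_compose)
  moreover have "sum r {- int n..int n} = variance_increment \<rho> n" for n
  proof (induction n)
    case (Suc n)
    have "{- int (Suc n)..int (Suc n)} = insert (- int (Suc n)) (insert (int (Suc n)) {- int n..int n})"
      by auto
    then have "sum r {- int (Suc n)..int (Suc n)} = r (- int (Suc n)) + (r (int (Suc n)) + sum r {- int n..int n})"
      by simp
    also have "\<dots> = variance_increment \<rho> (Suc n)"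
      unfolding Suc.IH r_even by (simp add: variance_increment_def)
    finally show ?case .
  qed (simp add: variance_increment_def)
  ultimately show ?thesis by simp
qed

end

section \<open>Growth of the profits\<close>

text \<open>An integrable minorant keeps the negative part of \<open>X\<close> finite, which rules
  out the branch with value -\<infinity>; positive and negative parts are then compared
  separately.\<close>

lemma (in prob_space) ext_expectation_ge:
  assumes "integrable M Y" "\<And>\<omega>. \<omega> \<in> space M \<Longrightarrow> Y \<omega> \<le> X \<omega>"
  shows "ereal (expectation Y) \<le> ext_expectation M X"
proof -
  have pos: "(\<integral>\<^sup>+\<omega>. ennreal (max (Y \<omega>) 0) \<partial>M) = ennreal (expectation (\<lambda>\<omega>. max (Y \<omega>) 0))"
    using assms by (intro nn_integral_eq_integral) auto
  have neg: "(\<integral>\<^sup>+\<omega>. ennreal (max (- Y \<omega>) 0) \<partial>M) = ennreal (expectation (\<lambda>\<omega>. max (- Y \<omega>) 0))"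
    using assms by (intro nn_integral_eq_integral) auto
  have X_neg: "(\<integral>\<^sup>+\<omega>. ennreal (max (- X \<omega>) 0) \<partial>M) \<le> ennreal (expectation (\<lambda>\<omega>. max (- Y \<omega>) 0))"
    unfolding neg[symmetric] using assms(2) by (intro nn_integral_mono ennreal_leI) fastforce
  have X_pos: "ennreal (expectation (\<lambda>\<omega>. max (Y \<omega>) 0)) \<le> (\<integral>\<^sup>+\<omega>. ennreal (max (X \<omega>) 0) \<partial>M)"
    unfolding pos[symmetric] using assms(2) by (intro nn_integral_mono ennreal_leI) fastforce
  have "expectation Y = expectation (\<lambda>\<omega>. max (Y \<omega>) 0 - max (- Y \<omega>) 0)"
    by (intro Bochner_Integration.integral_cong) auto
  also have "\<dots> = expectation (\<lambda>\<omega>. max (Y \<omega>) 0) - expectation (\<lambda>\<omega>. max (- Y \<omega>) 0)"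
    using assms by simp
  finally have "ereal (expectation Y) =
      enn2ereal (ennreal (expectation (\<lambda>\<omega>. max (Y \<omega>) 0))) - enn2ereal (ennreal (expectation (\<lambda>\<omega>. max (- Y \<omega>) 0)))"
    by (simp add: enn2ereal_ennreal)
  also have "\<dots> \<le> enn2ereal (\<integral>\<^sup>+\<omega>. ennreal (max (X \<omega>) 0) \<partial>M) - enn2ereal (\<integral>\<^sup>+\<omega>. ennreal (max (- X \<omega>) 0) \<partial>M)"
    using X_pos X_neg by (intro ereal_minus_mono) (simp_all add: less_eq_ennreal.rep_eq)
  also have "\<dots> = ext_expectation M X"
    using X_neg by (auto simp: ext_expectation_def top_unique)
  finally show ?thesis .
qed

text \<open>A nonnegative majorant dominates the positive part of \<open>X\<close>; the negative
  part can only lower the value, down to -\<infinity> in the extreme case.\<close>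

lemma (in prob_space) ext_expectation_le:
  assumes "integrable M Y" "\<And>\<omega>. \<omega> \<in> space M \<Longrightarrow> X \<omega> \<le> Y \<omega>" "\<And>\<omega>. 0 \<le> Y \<omega>"
  shows "ext_expectation M X \<le> ereal (expectation Y)"
proof -
  have "(\<integral>\<^sup>+\<omega>. ennreal (max (X \<omega>) 0) \<partial>M) \<le> (\<integral>\<^sup>+\<omega>. ennreal (Y \<omega>) \<partial>M)"
    using assms(2,3) by (intro nn_integral_mono ennreal_leI) auto
  also have "\<dots> = ennreal (expectation Y)"
    using assms by (intro nn_integral_eq_integral) auto
  finally have "enn2ereal (\<integral>\<^sup>+\<omega>. ennreal (max (X \<omega>) 0) \<partial>M) \<le> ereal (expectation Y)"
    using assms(3) by (simp add: less_eq_ennreal.rep_eq enn2ereal_ennreal)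
  then have "enn2ereal (\<integral>\<^sup>+\<omega>. ennreal (max (X \<omega>) 0) \<partial>M) - enn2ereal b \<le> ereal (expectation Y) - 0" for b
    by (intro ereal_minus_mono) auto
  then show ?thesis by (simp add: ext_expectation_def)
qed

locale anti_persistent_noise = stationary_gaussian_noise M Z r
  for M :: "'a measure" and Z r +
  fixes T\<^sub>0 J\<^sub>1 J\<^sub>2 chi \<alpha> :: real
  assumes J_neg: "J\<^sub>1 < 0" "J\<^sub>2 < 0"
    and chi: "-2 < chi" "chi < -1"
    and r_bounds: "\<And>t::int. real_of_int t \<ge> T\<^sub>0 \<Longrightarrow>
           J\<^sub>1 * real_of_int t powr chi \<le> r t \<and> r t \<le> J\<^sub>2 * real_of_int t powr chi"
    and r_sum: "(r has_sum 0) UNIV"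
    and \<alpha>: "\<alpha> > 1"
begin

sublocale anti_persistent_covariance \<rho> "max 1 (nat \<lceil>T\<^sub>0\<rceil>)" J\<^sub>1 J\<^sub>2 chi
proof
  fix k assume "k \<ge> max 1 (nat \<lceil>T\<^sub>0\<rceil>)"
  then have "T\<^sub>0 \<le> real_of_int (int k)" by linarith
  from r_bounds[OF this] show "J\<^sub>1 * real k powr chi \<le> \<rho> k" "\<rho> k \<le> J\<^sub>2 * real k powr chi"
    by auto
qed (use J_neg chi variance_increment_tendsto_0[OF r_sum] in auto)

definition \<beta> :: real where "\<beta> = 1 + 1 / (\<alpha> - 1)"

text \<open>Growth exponent of the \<beta>-th absolute moment of \<open>S t\<close>, whose variance
  is of order t^(chi + 2); summing over t raises it to p + 1.\<close>

definition p :: real where "p = (chi / 2 + 1) * \<beta>"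

abbreviation v :: "nat \<Rightarrow> real" where "v \<equiv> walk_variance \<rho>"

text \<open>The contrarian trade with its sign reversed; up to the factor \<beta> it is the
  derivative of |.|^\<beta> at the price, as it occurs in the tangent inequality.\<close>

definition signed_power :: "nat \<Rightarrow> 'a \<Rightarrow> real" where
  "signed_power t \<omega> = sgn (S t \<omega>) * \<bar>S t \<omega>\<bar> powr (\<beta> - 1)"

definition abs_moment :: "nat \<Rightarrow> real" where
  "abs_moment t = expectation (\<lambda>\<omega>. \<bar>S t \<omega>\<bar> powr \<beta>)"

text \<open>The factor of \<open>cov(S\<^sub>t, Y)\<close> in the bound for \<open>E[sgn(S\<^sub>t) \<bar>S\<^sub>t\<bar>\<^sup>\<beta>\<^sup>-\<^sup>1 Y]\<close>. It vanishes when
  \<open>v t = 0\<close>, whatever the exponent, because \<open>0 powr x = 0\<close>.\<close>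

definition cross_weight :: "nat \<Rightarrow> real" where
  "cross_weight t = normal_abs_moment \<beta> * v t powr (\<beta> / 2 - 1)"

section \<open>Moments of the price and the upper bound on all profits\<close>

lemma \<beta>_gt_1: "\<beta> > 1"
  using \<alpha> by (simp add: \<beta>_def)

lemma p_pos: "p > 0"
  using chi \<beta>_gt_1 by (simp add: p_def)

lemma v_nonneg: "v t \<ge> 0"
  unfolding S_variance[symmetric] by simp

lemma S_powr_integrable: "integrable M (\<lambda>\<omega>. \<bar>S t \<omega>\<bar> powr \<beta>)"
  using centered_gaussian_abs_moment(1)[OF S_gaussian S_mean] \<beta>_gt_1 by simp

lemma abs_moment_eq: "abs_moment t = normal_abs_moment \<beta> * v t powr (\<beta> / 2)"
  unfolding abs_moment_def S_variance[symmetric]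
  using centered_gaussian_abs_moment(2)[OF S_gaussian S_mean] \<beta>_gt_1 by simp

lemma abs_moment_eq_cross_weight: "abs_moment t = cross_weight t * v t"
  using v_nonneg[of t] by (cases "v t = 0") (simp_all add: abs_moment_eq cross_weight_def powr_diff)

lemma abs_moment_nonneg: "abs_moment t \<ge> 0"
  by (simp add: abs_moment_def)

lemma cross_weight_nonneg: "cross_weight t \<ge> 0"
  using normal_abs_moment_pos[of \<beta>] \<beta>_gt_1 by (simp add: cross_weight_def)

lemma abs_moment_sum_upper:
  obtains K where "K > 0" "\<And>n. (\<Sum>t=0..n. abs_moment t) \<le> K * real n powr (p + 1)"
proof -
  obtain C where C: "C > 0" "\<And>t. t \<ge> 1 \<Longrightarrow> v t \<le> C * real t powr (chi + 2)"
    using walk_variance_upper by blast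
  define K where "K = normal_abs_moment \<beta> * C powr (\<beta> / 2)"
  have \<kappa>: "normal_abs_moment \<beta> > 0"
    using normal_abs_moment_pos[of \<beta>] \<beta>_gt_1 by simp
  have "K > 0" unfolding K_def using \<kappa> C by simp
  have abs_moment: "abs_moment t \<le> K * real t powr p" if "t \<ge> 1" for t
  proof -
    have "v t powr (\<beta> / 2) \<le> (C * real t powr (chi + 2)) powr (\<beta> / 2)"
      using C that v_nonneg \<beta>_gt_1 by (intro powr_mono2) auto
    also have "\<dots> = C powr (\<beta> / 2) * real t powr p"
      using C by (simp add: powr_mult powr_powr p_def field_simps)
    finally show ?thesis
      unfolding abs_moment_eq K_def using \<kappa> by simp
  qed
  have "(\<Sum>t=0..n. abs_moment t) \<le> K * real n powr (p + 1)" for n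
  proof -
    \<comment> \<open>The term at time 0 vanishes, which leaves n terms and makes the bound correct
      for n = 0 too.\<close>
    have "(\<Sum>t=0..n. abs_moment t) = (\<Sum>t=1..n. abs_moment t)"
      using \<beta>_gt_1 by (simp add: sum.atLeast_Suc_atMost abs_moment_def)
    also have "\<dots> \<le> (\<Sum>t=1..n. K * real n powr p)"
    proof (rule sum_mono)
      fix t assume t: "t \<in> {1..n}"
      then have "K * real t powr p \<le> K * real n powr p"
        using \<open>K > 0\<close> p_pos by (intro mult_left_mono powr_mono2) auto
      with abs_moment[of t] t show "abs_moment t \<le> K * real n powr p" by simp
    qed
    also have "\<dots> = K * real n powr (p + 1)"
      by (simp add: powr_add)
    finally show ?thesis .
  qed
  with \<open>K > 0\<close> show ?thesis using that by blast
qed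

lemma max_profit_upper:
  assumes "lam > 0"
  shows "\<exists>C. \<forall>T. max_profit M Z lam \<alpha> T \<le> ereal (C * real T powr (p + 1))"
proof -
  obtain K where K: "K > 0" "\<And>n. (\<Sum>t=0..n. abs_moment t) \<le> K * real n powr (p + 1)"
    using abs_moment_sum_upper by blast
  define L where "L = lam powr (- 1 / (\<alpha> - 1))"
  have "L \<ge> 0" by (simp add: L_def)
  have "ext_expectation M (terminal_cash Z lam \<alpha> T \<phi>) \<le> ereal (L * K * real T powr (p + 1))" for T \<phi>
  proof -
    define Y where "Y \<omega> = (\<Sum>u=0..T. L * \<bar>S u \<omega>\<bar> powr \<beta>)" for \<omega>
    have "terminal_cash Z lam \<alpha> T \<phi> \<omega> \<le> Y \<omega>" for \<omega>
    proof -
      have "terminal_cash Z lam \<alpha> T \<phi> \<omega> = (\<Sum>u=0..T. - \<phi> u \<omega> * S u \<omega> - lam * \<bar>\<phi> u \<omega>\<bar> powr \<alpha>)"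
        by (simp add: terminal_cash_def sum_subtractf sum_negf)
      also have "\<dots> \<le> Y \<omega>"
        unfolding Y_def L_def \<beta>_def using \<alpha> assms
        by (intro sum_mono price_impact_conjugate_bound) auto
      finally show ?thesis .
    qed
    then have "ext_expectation M (terminal_cash Z lam \<alpha> T \<phi>) \<le> ereal (expectation Y)"
      using S_powr_integrable \<open>L \<ge> 0\<close>
      by (intro ext_expectation_le) (auto simp: Y_def[abs_def] intro!: sum_nonneg)
    also have "expectation Y = L * (\<Sum>u=0..T. abs_moment u)"
      unfolding Y_def[abs_def] using S_powr_integrable by (simp add: abs_moment_def sum_distrib_left)
    also have "ereal \<dots> \<le> ereal (L * K * real T powr (p + 1))"
      using K(2)[of T] \<open>L \<ge> 0\<close> by (simp add: mult.assoc mult_left_mono)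
    finally show ?thesis .
  qed
  then show ?thesis
    unfolding max_profit_def by (intro exI[of _ "L * K"] allI SUP_least)
qed

section \<open>Pathwise and expected profit of the contrarian strategy\<close>

lemma signed_power_expectation:
  assumes "s \<le> t"
  shows "integrable M (\<lambda>\<omega>. signed_power s \<omega> * S t \<omega>)"
    and "expectation (\<lambda>\<omega>. signed_power s \<omega> * S t \<omega>) \<le> abs_moment s + cross_weight s * increment_cov \<rho> s (t - s)"
proof -
  have "gaussian_rv M (\<lambda>\<omega>. S s \<omega> + b * S t \<omega>)" for b
    using S_combination_gaussian[of 1 s b t] by simp
  note cross = gaussian_power_cross_moment[OF this S_gaussian S_mean S_mean \<beta>_gt_1]
  show "integrable M (\<lambda>\<omega>. signed_power s \<omega> * S t \<omega>)"
    using cross(1) by (simp add: signed_power_def)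
  have "expectation (\<lambda>\<omega>. signed_power s \<omega> * S t \<omega>) \<le> cross_weight s * expectation (\<lambda>\<omega>. S s \<omega> * S t \<omega>)"
    using cross(2) by (simp add: signed_power_def cross_weight_def S_variance)
  \<comment> \<open>The product of \<open>cross_weight s\<close> and \<open>v s\<close> is the
    moment earned in the first phase; only the term with \<open>increment_cov\<close> will survive
    the cancellation.\<close>
  also have "expectation (\<lambda>\<omega>. S s \<omega> * S t \<omega>) = v s + increment_cov \<rho> s (t - s)"
    using S_product_expectation[of s "t - s"] assms by simp
  finally show "expectation (\<lambda>\<omega>. signed_power s \<omega> * S t \<omega>) \<le> abs_moment s + cross_weight s * increment_cov \<rho> s (t - s)"
    by (simp add: abs_moment_eq_cross_weight distrib_left)
qed

text \<open>The exponents satisfy (\<beta> - 1) \<alpha> = \<beta>, so the impact cost of a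
  contrarian trade is \<open>lam\<close> times its revenue.\<close>

lemma abs_signed_power_powr: "\<bar>signed_power s \<omega>\<bar> powr \<alpha> = \<bar>S s \<omega>\<bar> powr \<beta>"
proof -
  have "\<bar>signed_power s \<omega>\<bar> = \<bar>S s \<omega>\<bar> powr (\<beta> - 1)"
    by (auto simp: signed_power_def abs_mult sgn_if)
  moreover have "(\<beta> - 1) * \<alpha> = \<beta>"
    using \<alpha> by (simp add: \<beta>_def field_simps)
  ultimately show ?thesis by (simp add: powr_powr)
qed

text \<open>The first phase earns \<open>1 - lam\<close> times the power sum. By Jensen's inequality
  the impact cost of the liquidation is at most another \<open>lam\<close> times that sum, hence
  \<open>1 - 2 * lam\<close>; the double sum is the market cost of buying back at constant
  speed.\<close>

lemma terminal_cash_lower: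
  assumes "lam > 0" and k: "k = T div 6" "k \<ge> 1"
  shows "(1 - 2 * lam) * (\<Sum>s=1..3*k. \<bar>S s \<omega>\<bar> powr \<beta>)
      - (\<Sum>t\<in>{3*k<..6*k}. \<Sum>s=1..3*k. signed_power s \<omega> * S t \<omega>) / real (3 * k)
    \<le> terminal_cash Z lam \<alpha> T (contrarian_strategy Z T \<alpha>) \<omega>"
proof -
  define \<phi> where "\<phi> = contrarian_strategy Z T \<alpha>"
  define A where "A = (\<Sum>s=1..3*k. signed_power s \<omega>) / real (3 * k)"
  define h where "h u = \<phi> u \<omega> * S u \<omega> + lam * \<bar>\<phi> u \<omega>\<bar> powr \<alpha>" for u
  have trade: "contrarian_trade Z \<alpha> u \<omega> = - signed_power u \<omega>" for u
    by (simp add: contrarian_trade_def signed_power_def \<beta>_def)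
  \<comment> \<open>The strategy divides a sum of 3 k + 1 trades by 3 k; as the trade at time 0 is
    zero, \<open>A\<close> is a genuine average.\<close>
  have f0: "signed_power 0 \<omega> = 0" by (simp add: signed_power_def)
  have S0: "\<bar>S 0 \<omega>\<bar> powr \<beta> = 0" by simp
  have "{0..T} = {0..3*k} \<union> {3*k<..6*k} \<union> {6*k<..T}"
    using k by auto
  then have "(\<Sum>u=0..T. h u) = (\<Sum>u=0..3*k. h u) + (\<Sum>u\<in>{3*k<..6*k}. h u) + (\<Sum>u\<in>{6*k<..T}. h u)"
  proof -
    have "({0..3*k} \<union> {3*k<..6*k}) \<inter> {6*k<..T} = {}" "{0..3*k} \<inter> {3*k<..6*k} = {}"
      by auto
    then show ?thesis
      unfolding \<open>{0..T} = _\<close> by (simp add: sum.union_disjoint del: ivl_disj_un)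
  qed
  moreover have "(\<Sum>u\<in>{6*k<..T}. h u) = 0"
    using k \<alpha> by (intro sum.neutral) (auto simp: h_def \<phi>_def contrarian_strategy_def)
  moreover have "(\<Sum>u=0..3*k. h u) = - (1 - lam) * (\<Sum>s=1..3*k. \<bar>S s \<omega>\<bar> powr \<beta>)"
  proof -
    have "h u = - (1 - lam) * \<bar>S u \<omega>\<bar> powr \<beta>" if "u \<le> 3 * k" for u
    proof -
      have "signed_power u \<omega> * S u \<omega> = \<bar>S u \<omega>\<bar> powr \<beta>"
        by (cases "S u \<omega> = 0") (auto simp: signed_power_def powr_diff sgn_if)
      then show ?thesis
        using that k abs_signed_power_powr[of u \<omega>]
        by (simp add: h_def \<phi>_def contrarian_strategy_def trade algebra_simps)
    qed
    then have "(\<Sum>u=0..3*k. h u) = - (1 - lam) * (\<Sum>u=0..3*k. \<bar>S u \<omega>\<bar> powr \<beta>)"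
      by (simp add: sum_distrib_left)
    also have "(\<Sum>u=0..3*k. \<bar>S u \<omega>\<bar> powr \<beta>) = (\<Sum>u=1..3*k. \<bar>S u \<omega>\<bar> powr \<beta>)"
      using S0 by (simp add: sum.atLeast_Suc_atMost)
    finally show ?thesis .
  qed
  moreover have "(\<Sum>u\<in>{3*k<..6*k}. h u) \<le>
      (\<Sum>t\<in>{3*k<..6*k}. \<Sum>s=1..3*k. signed_power s \<omega> * S t \<omega>) / real (3 * k) + lam * (\<Sum>s=1..3*k. \<bar>S s \<omega>\<bar> powr \<beta>)"
  proof -
    have "(\<Sum>s=0..3*k. signed_power s \<omega>) = (\<Sum>s=1..3*k. signed_power s \<omega>)"
      using f0 by (simp add: sum.atLeast_Suc_atMost)
    then have "\<phi> u \<omega> = A" if "u \<in> {3*k<..6*k}" for u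
      using that k by (auto simp: \<phi>_def contrarian_strategy_def trade A_def sum_negf)
    then have "(\<Sum>u\<in>{3*k<..6*k}. h u) = (\<Sum>u\<in>{3*k<..6*k}. A * S u \<omega> + lam * \<bar>A\<bar> powr \<alpha>)"
      by (intro sum.cong) (auto simp: h_def)
    \<comment> \<open>There are as many liquidation times as averaged trades, so the total impact
      cost has the shape required by Jensen's inequality.\<close>
    also have "\<dots> = (\<Sum>u\<in>{3*k<..6*k}. A * S u \<omega>) + lam * (real (card {1..3*k}) * \<bar>A\<bar> powr \<alpha>)"
      by (simp add: sum.distrib)
    also have "real (card {1..3*k}) * \<bar>A\<bar> powr \<alpha> \<le> (\<Sum>s=1..3*k. \<bar>signed_power s \<omega>\<bar> powr \<alpha>)"
      using abs_sum_powr_le[of \<alpha> "{1..3*k}" "\<lambda>s. signed_power s \<omega>"] \<alpha> k by (simp add: A_def)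
    finally show ?thesis
      using \<open>lam > 0\<close>
      by (simp add: A_def abs_signed_power_powr sum_distrib_right sum_divide_distrib)
  qed
  ultimately have "(\<Sum>u=0..T. h u) \<le> - (1 - lam) * (\<Sum>s=1..3*k. \<bar>S s \<omega>\<bar> powr \<beta>) +
      (\<Sum>t\<in>{3*k<..6*k}. \<Sum>s=1..3*k. signed_power s \<omega> * S t \<omega>) / real (3 * k) + lam * (\<Sum>s=1..3*k. \<bar>S s \<omega>\<bar> powr \<beta>)"
    by linarith
  moreover have "terminal_cash Z lam \<alpha> T \<phi> \<omega> = - (\<Sum>u=0..T. h u)"
    by (simp add: terminal_cash_def h_def sum.distrib)
  ultimately show ?thesis
    unfolding \<phi>_def[symmetric] by (simp add: algebra_simps)
qed

text \<open>Each of the 3 k liquidation times charges every \<open>abs_moment s\<close> with weight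
  1 / (3 k). Together they cancel the leading gain of the first phase, leaving only the impact term
  and the covariance correction.\<close>

lemma contrarian_profit_lower:
  assumes "lam > 0" and k: "k = T div 6" "k \<ge> 1"
  shows "ereal (- 2 * lam * (\<Sum>s=1..3*k. abs_moment s)
      - (\<Sum>t\<in>{3*k<..6*k}. \<Sum>s=1..3*k. cross_weight s * increment_cov \<rho> s (t - s)) / real (3 * k))
    \<le> ext_expectation M (terminal_cash Z lam \<alpha> T (contrarian_strategy Z T \<alpha>))"
proof -
  define Q where "Q \<omega> = (\<Sum>t\<in>{3*k<..6*k}. \<Sum>s=1..3*k. signed_power s \<omega> * S t \<omega>)" for \<omega>
  define Y where "Y \<omega> = (1 - 2 * lam) * (\<Sum>s=1..3*k. \<bar>S s \<omega>\<bar> powr \<beta>) - Q \<omega> / real (3 * k)" for \<omega>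
  have int_fS: "integrable M (\<lambda>\<omega>. signed_power s \<omega> * S t \<omega>)" if "t \<in> {3*k<..6*k}" "s \<in> {1..3*k}" for s t
    using that by (intro signed_power_expectation) auto
  have "integrable M Q"
    unfolding Q_def by (intro Bochner_Integration.integrable_sum int_fS)
  then have "integrable M Y"
    unfolding Y_def[abs_def] using S_powr_integrable by simp
  have "expectation Q = (\<Sum>t\<in>{3*k<..6*k}. expectation (\<lambda>\<omega>. \<Sum>s=1..3*k. signed_power s \<omega> * S t \<omega>))"
    unfolding Q_def
    by (intro Bochner_Integration.integral_sum Bochner_Integration.integrable_sum int_fS)
  also have "\<dots> = (\<Sum>t\<in>{3*k<..6*k}. \<Sum>s=1..3*k. expectation (\<lambda>\<omega>. signed_power s \<omega> * S t \<omega>))"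
    by (intro sum.cong refl Bochner_Integration.integral_sum int_fS)
  finally have Q: "expectation Q = \<dots>" .
  have sum_le: "(\<Sum>t\<in>{3*k<..6*k}. \<Sum>s=1..3*k. expectation (\<lambda>\<omega>. signed_power s \<omega> * S t \<omega>))
      \<le> (\<Sum>t\<in>{3*k<..6*k}. \<Sum>s=1..3*k. abs_moment s + cross_weight s * increment_cov \<rho> s (t - s))"
    by (intro sum_mono signed_power_expectation) auto
  have "expectation Y = (1 - 2 * lam) * (\<Sum>s=1..3*k. abs_moment s)
      - (\<Sum>t\<in>{3*k<..6*k}. \<Sum>s=1..3*k. expectation (\<lambda>\<omega>. signed_power s \<omega> * S t \<omega>)) / real (3 * k)"
    unfolding Q[symmetric] Y_def[abs_def] using S_powr_integrable \<open>integrable M Q\<close>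
    by (simp add: abs_moment_def)
  also have "\<dots> \<ge> (1 - 2 * lam) * (\<Sum>s=1..3*k. abs_moment s)
      - (\<Sum>t\<in>{3*k<..6*k}. \<Sum>s=1..3*k. abs_moment s + cross_weight s * increment_cov \<rho> s (t - s)) / real (3 * k)"
    using sum_le by (intro diff_left_mono divide_right_mono) auto
  also have "(\<Sum>t\<in>{3*k<..6*k}. \<Sum>s=1..3*k. abs_moment s + cross_weight s * increment_cov \<rho> s (t - s)) / real (3 * k) =
      (\<Sum>s=1..3*k. abs_moment s) + (\<Sum>t\<in>{3*k<..6*k}. \<Sum>s=1..3*k. cross_weight s * increment_cov \<rho> s (t - s)) / real (3 * k)"
    using k by (simp add: sum.distrib add_divide_distrib)
  finally have "- 2 * lam * (\<Sum>s=1..3*k. abs_moment s)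
      - (\<Sum>t\<in>{3*k<..6*k}. \<Sum>s=1..3*k. cross_weight s * increment_cov \<rho> s (t - s)) / real (3 * k) \<le> expectation Y"
    by (simp add: algebra_simps)
  then have "ereal (- 2 * lam * (\<Sum>s=1..3*k. abs_moment s)
      - (\<Sum>t\<in>{3*k<..6*k}. \<Sum>s=1..3*k. cross_weight s * increment_cov \<rho> s (t - s)) / real (3 * k)) \<le> ereal (expectation Y)"
    by simp
  also have "\<dots> \<le> ext_expectation M (terminal_cash Z lam \<alpha> T (contrarian_strategy Z T \<alpha>))"
    using terminal_cash_lower[OF assms] by (intro ext_expectation_ge \<open>integrable M Y\<close>) (simp add: Y_def Q_def)
  finally show ?thesis .
qed

end

section \<open>Asymptotic size of the covariance correction\<close>

context anti_persistent_noise
begin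

lemma cov_correction_upper:
  obtains c C k\<^sub>0 where "c > 0" "C \<ge> 0"
    "\<And>k. k \<ge> k\<^sub>0 \<Longrightarrow> k \<ge> 1 \<Longrightarrow>
      (\<Sum>t\<in>{3*k<..6*k}. \<Sum>s=1..3*k. cross_weight s * increment_cov \<rho> s (t - s)) / real (3 * k)
      \<le> C * (\<Sum>s=1..3*k. cross_weight s) - c * real k powr (chi + 2) * (\<Sum>s=k..2*k. cross_weight s)"
proof -
  define N where "N = max 1 (nat \<lceil>T\<^sub>0\<rceil>)"
  obtain c C where cC: "c > 0" "C \<ge> 0" "\<And>s d. increment_cov \<rho> s d \<le> C"
    "\<And>k s d. \<lbrakk>2 * N \<le> k; k \<le> s; k \<le> d; s + d \<le> 6 * k\<rbrakk> \<Longrightarrow>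
      increment_cov \<rho> s d \<le> C - c * real k powr (chi + 2)"
    unfolding N_def using increment_cov_bounds by blast
  have "(\<Sum>t\<in>{3*k<..6*k}. \<Sum>s=1..3*k. cross_weight s * increment_cov \<rho> s (t - s)) / real (3 * k)
      \<le> C * (\<Sum>s=1..3*k. cross_weight s) - c * real k powr (chi + 2) * (\<Sum>s=k..2*k. cross_weight s)"
    if k: "k \<ge> 2 * N" "k \<ge> 1" for k
  proof -
    define q where "q = c * real k powr (chi + 2)"
    have "(\<Sum>s=1..3*k. cross_weight s * increment_cov \<rho> s (t - s)) \<le> C * (\<Sum>s=1..3*k. cross_weight s) - q * (\<Sum>s=k..2*k. cross_weight s)"
      if t: "t \<in> {3*k<..6*k}" for t
    proof -
      have "(\<Sum>s=1..3*k. cross_weight s * increment_cov \<rho> s (t - s))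
          \<le> (\<Sum>s=1..3*k. C * cross_weight s - (if s \<in> {k..2*k} then q * cross_weight s else 0))"
      proof (rule sum_mono)
        fix s assume "s \<in> {1..3*k}"
        \<comment> \<open>For s \<le> 2 k and t > 3 k the distance t - s is at least k, and s + (t -
          s) = t \<le> 6 k, so the strong bound applies in the middle third.\<close>
        have "increment_cov \<rho> s (t - s) \<le> C - (if s \<in> {k..2*k} then q else 0)"
          using cC(3)[of s "t - s"] cC(4)[of k s "t - s"] t k by (auto simp: q_def)
        then have "cross_weight s * increment_cov \<rho> s (t - s) \<le> cross_weight s * (C - (if s \<in> {k..2*k} then q else 0))"
          using cross_weight_nonneg by (intro mult_left_mono)
        then show "cross_weight s * increment_cov \<rho> s (t - s) \<le> C * cross_weight s - (if s \<in> {k..2*k} then q * cross_weight s else 0)"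
          by (cases "s \<in> {k..2*k}") (auto simp: algebra_simps)
      qed
      also have "\<dots> = C * (\<Sum>s=1..3*k. cross_weight s) - (\<Sum>s=1..3*k. if s \<in> {k..2*k} then q * cross_weight s else 0)"
        by (simp add: sum_subtractf sum_distrib_left)
      also have "(\<Sum>s=1..3*k. if s \<in> {k..2*k} then q * cross_weight s else 0) = (\<Sum>s=k..2*k. q * cross_weight s)"
        using k by (intro sum.mono_neutral_cong_right) auto
      finally show ?thesis by (simp add: sum_distrib_left)
    qed
    then have "(\<Sum>t\<in>{3*k<..6*k}. \<Sum>s=1..3*k. cross_weight s * increment_cov \<rho> s (t - s))
        \<le> of_nat (card {3*k<..6*k}) * (C * (\<Sum>s=1..3*k. cross_weight s) - q * (\<Sum>s=k..2*k. cross_weight s))"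
      by (intro sum_bounded_above)
    then show ?thesis
      using k by (simp add: q_def field_simps)
  qed
  with cC(1,2) show ?thesis using that by blast
qed

text \<open>For s between k and 2 k the variance is of order x = k^(chi + 2). About k summands of
  order x^q, multiplied by x, give the power p + 1 of k because (chi + 2) (q + 1) = p.\<close>

lemma cross_weight_middle_sum_lower:
  obtains m k\<^sub>0 where "m > 0"
    "\<And>k. k \<ge> k\<^sub>0 \<Longrightarrow> m * real k powr (p + 1) \<le> real k powr (chi + 2) * (\<Sum>s=k..2*k. cross_weight s)"
proof -
  obtain C where C: "C > 0" "\<And>t. t \<ge> 1 \<Longrightarrow> v t \<le> C * real t powr (chi + 2)"
    using walk_variance_upper by blast
  obtain c t\<^sub>0 where c: "c > 0" "t\<^sub>0 \<ge> 1" "\<And>t. t \<ge> t\<^sub>0 \<Longrightarrow> c * real t powr (chi + 2) \<le> v t"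
    using walk_variance_lower by blast
  define q where "q = \<beta> / 2 - 1"
  define C' where "C' = C * 2 powr (chi + 2)"
  \<comment> \<open>The sign of \<open>q\<close> depends on whether \<beta> reaches 2: the lower
    variance bound serves q \<ge> 0, the upper one q < 0, and the minimum covers both.\<close>
  define m where "m = normal_abs_moment \<beta> * min (c powr q) (C' powr q)"
  have \<kappa>: "normal_abs_moment \<beta> > 0"
    using normal_abs_moment_pos[of \<beta>] \<beta>_gt_1 by simp
  have "C' > 0" unfolding C'_def using C by simp
  then have "m > 0" unfolding m_def using \<kappa> c by simp
  have "m * real k powr (p + 1) \<le> real k powr (chi + 2) * (\<Sum>s=k..2*k. cross_weight s)" if k: "k \<ge> t\<^sub>0" for k
  proof -
    have kpos: "real k > 0" using k c(2) by simp
    define x where "x = real k powr (chi + 2)"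
    have "x > 0" using kpos by (simp add: x_def)
    have "m * x powr q \<le> cross_weight s" if s: "s \<in> {k..2*k}" for s
    proof -
      have "c * x \<le> c * real s powr (chi + 2)"
        unfolding x_def using s c chi by (intro mult_left_mono powr_mono2) auto
      also have "\<dots> \<le> v s" using s k by (intro c) auto
      finally have lo: "c * x \<le> v s" .
      have "v s \<le> C * real s powr (chi + 2)"
        using s k c(2) by (intro C) auto
      also have "\<dots> \<le> C * (2 * real k) powr (chi + 2)"
        using s C chi by (intro mult_left_mono powr_mono2) auto
      also have "\<dots> = C' * x"
        by (simp add: C'_def x_def powr_mult)
      finally have hi: "v s \<le> C' * x" .
      have "c * x > 0" using c \<open>x > 0\<close> by simp
      have "min (c powr q) (C' powr q) * x powr q \<le> v s powr q"
      proof (cases "q \<ge> 0")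
        case True
        have "min (c powr q) (C' powr q) * x powr q \<le> c powr q * x powr q"
          by (intro mult_right_mono) auto
        also have "\<dots> = (c * x) powr q"
          using c \<open>x > 0\<close> by (simp add: powr_mult)
        also have "\<dots> \<le> v s powr q"
          using lo True \<open>c * x > 0\<close> by (intro powr_mono2) auto
        finally show ?thesis .
      next
        case False
        have "min (c powr q) (C' powr q) * x powr q \<le> C' powr q * x powr q"
          by (intro mult_right_mono) auto
        also have "\<dots> = (C' * x) powr q"
          using \<open>C' > 0\<close> \<open>x > 0\<close> by (simp add: powr_mult)
        also have "\<dots> \<le> v s powr q"
          using lo hi False \<open>c * x > 0\<close> by (intro powr_mono2') auto
        finally show ?thesis .
      qed
      then show ?thesis
        unfolding m_def cross_weight_def q_def[symmetric] using \<kappa> by (simp add: mult.assoc)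
    qed
    then have "of_nat (card {k..2*k}) * (m * x powr q) \<le> (\<Sum>s=k..2*k. cross_weight s)"
      by (intro sum_bounded_below)
    moreover have "real k * (m * x powr q) \<le> of_nat (card {k..2*k}) * (m * x powr q)"
      using \<open>m > 0\<close> by (intro mult_right_mono) auto
    ultimately have "x * (real k * (m * x powr q)) \<le> x * (\<Sum>s=k..2*k. cross_weight s)"
      using \<open>x > 0\<close> by (intro mult_left_mono) auto
    also have "x * (real k * (m * x powr q)) = m * real k powr (p + 1)"
    proof -
      have "x * x powr q = real k powr p"
        using kpos by (simp add: x_def powr_powr q_def p_def field_simps flip: powr_add)
      then show ?thesis
        using kpos by (simp add: powr_add mult_ac)
    qed
    finally show ?thesis by (simp add: x_def)
  qed
  with \<open>m > 0\<close> show ?thesis using that by blast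
qed

text \<open>\<open>abs_moment s\<close> is \<open>cross_weight s * v s\<close>, and
  \<open>v s\<close> tends to infinity, so the moment wins for large \<open>s\<close>;
  \<open>B\<close> absorbs the finitely many other terms.\<close>

lemma cross_weight_small_relative_to_moment:
  assumes "\<epsilon> > 0" "C \<ge> 0"
  obtains B where "B \<ge> 0" "\<And>s. C * cross_weight s \<le> \<epsilon> * abs_moment s + B"
proof -
  obtain c t\<^sub>0 where c: "c > 0" "t\<^sub>0 \<ge> 1" "\<And>t. t \<ge> t\<^sub>0 \<Longrightarrow> c * real t powr (chi + 2) \<le> v t"
    using walk_variance_lower by blast
  have "filterlim (\<lambda>t. real t powr (chi + 2)) at_top sequentially"
    using chi by (intro filterlim_nat_powr_at_top) auto
  then have "\<forall>\<^sub>F t in sequentially. real t powr (chi + 2) \<ge> C / (\<epsilon> * c)"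
    by (simp add: filterlim_at_top)
  then obtain t\<^sub>1 where t1: "\<And>t. t \<ge> t\<^sub>1 \<Longrightarrow> real t powr (chi + 2) \<ge> C / (\<epsilon> * c)"
    by (auto simp: eventually_sequentially)
  define s\<^sub>0 where "s\<^sub>0 = max t\<^sub>0 t\<^sub>1"
  define B where "B = (\<Sum>s<s\<^sub>0. C * cross_weight s)"
  have "B \<ge> 0" unfolding B_def using assms cross_weight_nonneg by (intro sum_nonneg) auto
  have "C * cross_weight s \<le> \<epsilon> * abs_moment s + B" for s
  proof (cases "s < s\<^sub>0")
    case True
    then have "C * cross_weight s \<le> B"
      unfolding B_def using assms cross_weight_nonneg by (intro member_le_sum) auto
    also have "\<dots> \<le> \<epsilon> * abs_moment s + B" using assms abs_moment_nonneg by simp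
    finally show ?thesis .
  next
    case False
    then have "C \<le> \<epsilon> * (c * real s powr (chi + 2))"
      using t1[of s] assms c by (simp add: s\<^sub>0_def field_simps)
    also have "\<dots> \<le> \<epsilon> * v s"
      using False c(3)[of s] assms by (intro mult_left_mono) (auto simp: s\<^sub>0_def)
    finally have "C * cross_weight s \<le> \<epsilon> * v s * cross_weight s"
      using cross_weight_nonneg by (intro mult_right_mono)
    then show ?thesis using \<open>B \<ge> 0\<close> by (simp add: abs_moment_eq_cross_weight mult_ac)
  qed
  with \<open>B \<ge> 0\<close> show ?thesis using that by blast
qed

lemma contrarian_profit_growth:
  "\<exists>lam\<^sub>0>0. \<exists>c>0. \<forall>lam. 0 < lam \<and> lam < lam\<^sub>0 \<longrightarrow>
    (\<forall>\<^sub>F T in sequentially. ereal (c * real T powr (p + 1)) \<le>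
      ext_expectation M (terminal_cash Z lam \<alpha> T (contrarian_strategy Z T \<alpha>)))"
proof -
  obtain K where K: "K > 0" "\<And>n. (\<Sum>t=0..n. abs_moment t) \<le> K * real n powr (p + 1)"
    using abs_moment_sum_upper by blast
  obtain c C k\<^sub>1 where c: "c > 0" "C \<ge> 0"
    "\<And>k. k \<ge> k\<^sub>1 \<Longrightarrow> k \<ge> 1 \<Longrightarrow>
      (\<Sum>t\<in>{3*k<..6*k}. \<Sum>s=1..3*k. cross_weight s * increment_cov \<rho> s (t - s)) / real (3 * k)
      \<le> C * (\<Sum>s=1..3*k. cross_weight s) - c * real k powr (chi + 2) * (\<Sum>s=k..2*k. cross_weight s)"
    using cov_correction_upper by blast
  obtain m k\<^sub>2 where m: "m > 0"
    "\<And>k. k \<ge> k\<^sub>2 \<Longrightarrow> m * real k powr (p + 1) \<le> real k powr (chi + 2) * (\<Sum>s=k..2*k. cross_weight s)"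
    using cross_weight_middle_sum_lower by blast
  define g where "g = c * m"
  define L where "L = K * 3 powr (p + 1)"
  have "g > 0" "L > 0" using c m K by (simp_all add: g_def L_def)
  \<comment> \<open>With x = k^(p + 1), the main gain is g x. The amount \<epsilon> E, at most g x /
    8, is spent twice, on the cross weights and on the impact with lam < \<epsilon> / 2; the
    constant \<open>B\<close> costs at most g x / 4. Thus g x / 2 remains.\<close>
  define \<epsilon> where "\<epsilon> = g / (8 * L)"
  have "\<epsilon> > 0" unfolding \<epsilon>_def using \<open>g > 0\<close> \<open>L > 0\<close> by simp
  obtain B where B: "B \<ge> 0" "\<And>s. C * cross_weight s \<le> \<epsilon> * abs_moment s + B"
    using cross_weight_small_relative_to_moment[OF \<open>\<epsilon> > 0\<close> c(2)] by blast
  have "filterlim (\<lambda>k. real k powr p) at_top sequentially"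
    using p_pos by (rule filterlim_nat_powr_at_top)
  \<comment> \<open>This threshold makes the accumulated error 3 k B at most a quarter of g k^(p +
    1).\<close>
  then have "\<forall>\<^sub>F k in sequentially. real k powr p \<ge> 12 * B / g"
    by (simp add: filterlim_at_top)
  then obtain k\<^sub>3 where k3: "\<And>k. k \<ge> k\<^sub>3 \<Longrightarrow> real k powr p \<ge> 12 * B / g"
    by (auto simp: eventually_sequentially)
  define k\<^sub>0 where "k\<^sub>0 = max (max k\<^sub>1 k\<^sub>2) (max k\<^sub>3 1)"
  have main: "ereal (g / 2 / 12 powr (p + 1) * real T powr (p + 1)) \<le>
      ext_expectation M (terminal_cash Z lam \<alpha> T (contrarian_strategy Z T \<alpha>))"
    if lam: "0 < lam" "lam < \<epsilon> / 2" and T: "T \<ge> 6 * k\<^sub>0 + 10" for lam T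
  proof -
    define k where "k = T div 6"
    have k: "k \<ge> k\<^sub>0" "k \<ge> 1" "k \<ge> k\<^sub>1" "k \<ge> k\<^sub>2" "k \<ge> k\<^sub>3"
      using T by (auto simp: k_def k\<^sub>0_def)
    define x where "x = real k powr (p + 1)"
    have "x > 0" using k by (simp add: x_def)
    \<comment> \<open>Rounding loses at most 5, so T \<le> 6 k + 5 \<le> 12 k as k \<ge> 1.\<close>
    have "real T \<le> 12 * real k" using T unfolding k_def by linarith
    then have "real T powr (p + 1) \<le> (12 * real k) powr (p + 1)"
      using p_pos by (intro powr_mono2) auto
    then have Tx: "real T powr (p + 1) \<le> 12 powr (p + 1) * x"
      by (simp add: powr_mult x_def)
    define E where "E = (\<Sum>s=1..3*k. abs_moment s)"
    have "E \<ge> 0" unfolding E_def using abs_moment_nonneg by (intro sum_nonneg)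
    have "E \<le> (\<Sum>s=0..3*k. abs_moment s)"
      unfolding E_def using abs_moment_nonneg by (intro sum_mono2) auto
    also have "\<dots> \<le> K * real (3 * k) powr (p + 1)" by (rule K)
    also have "\<dots> = L * x" by (simp add: L_def x_def powr_mult)
    finally have E: "E \<le> L * x" .
    have "C * (\<Sum>s=1..3*k. cross_weight s) \<le> (\<Sum>s=1..3*k. \<epsilon> * abs_moment s + B)"
      unfolding sum_distrib_left by (intro sum_mono B)
    also have "\<dots> = \<epsilon> * E + 3 * real k * B"
      by (simp add: sum.distrib E_def sum_distrib_left)
    also have "3 * real k * B \<le> g / 4 * x"
    proof -
      have "12 * B \<le> g * real k powr p"
        using k3[OF k(5)] \<open>g > 0\<close> by (simp add: field_simps)
      then have "real k * (12 * B) \<le> real k * (g * real k powr p)"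
        by (intro mult_left_mono) auto
      then show ?thesis by (simp add: x_def powr_add mult_ac)
    qed
    finally have cross_weight: "C * (\<Sum>s=1..3*k. cross_weight s) \<le> \<epsilon> * E + g / 4 * x" by simp
    have "c * (m * x) \<le> c * (real k powr (chi + 2) * (\<Sum>s=k..2*k. cross_weight s))"
      unfolding x_def using m(2)[OF k(4)] c by (intro mult_left_mono) auto
    then have mid: "g * x \<le> c * real k powr (chi + 2) * (\<Sum>s=k..2*k. cross_weight s)"
      by (simp add: g_def mult_ac)
    have "2 * lam * E \<le> \<epsilon> * E"
      using lam \<open>E \<ge> 0\<close> by (intro mult_right_mono) auto
    moreover have "\<epsilon> * E \<le> g / 8 * x"
    proof -
      have "\<epsilon> * E \<le> \<epsilon> * (L * x)" using E \<open>\<epsilon> > 0\<close> by (intro mult_left_mono) auto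
      also have "\<dots> = g / 8 * x" using \<open>L > 0\<close> by (simp add: \<epsilon>_def)
      finally show ?thesis .
    qed
    ultimately have "g / 2 * x \<le> - 2 * lam * E
        - (\<Sum>t\<in>{3*k<..6*k}. \<Sum>s=1..3*k. cross_weight s * increment_cov \<rho> s (t - s)) / real (3 * k)"
      using c(3)[OF k(3,2)] cross_weight mid by linarith
    moreover have "g / 2 / 12 powr (p + 1) * real T powr (p + 1) \<le> g / 2 * x"
      using Tx \<open>g > 0\<close> by (simp add: field_simps)
    ultimately have "g / 2 / 12 powr (p + 1) * real T powr (p + 1) \<le> - 2 * lam * E
        - (\<Sum>t\<in>{3*k<..6*k}. \<Sum>s=1..3*k. cross_weight s * increment_cov \<rho> s (t - s)) / real (3 * k)"
      by linarith
    then show ?thesis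
      using contrarian_profit_lower[OF lam(1) k_def k(2)] unfolding E_def
      by (meson ereal_less_eq(3) order_trans)
  qed
  have "\<forall>\<^sub>F T in sequentially. ereal (g / 2 / 12 powr (p + 1) * real T powr (p + 1)) \<le>
      ext_expectation M (terminal_cash Z lam \<alpha> T (contrarian_strategy Z T \<alpha>))"
    if "0 < lam" "lam < \<epsilon> / 2" for lam
    using main[OF that] by (rule eventually_sequentiallyI)
  moreover have "\<epsilon> / 2 > 0" "g / 2 / 12 powr (p + 1) > 0"
    using \<open>\<epsilon> > 0\<close> \<open>g > 0\<close> by simp_all
  ultimately show ?thesis by meson
qed

end

section \<open>Limits of the normalised profits\<close>

theorem theorem3p3:
  fixes M :: "'a measure" and Z :: "int \<Rightarrow> 'a \<Rightarrow> real"
    and r :: "int \<Rightarrow> real" and T\<^sub>0 J\<^sub>1 J\<^sub>2 chi \<alpha> :: real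
  assumes "prob_space M"
    and "gaussian_process M Z"
    and "stationary_process M Z"
    and "\<And>t. (LINT \<omega>|M. Z t \<omega>) = 0"
    and "\<And>t. r t = cov M (Z 0) (Z t)"
    and "T\<^sub>0 > 0" and "J\<^sub>1 < 0" and "J\<^sub>2 < 0" and "-2 < chi" and "chi < -1"
    and "\<And>t::int. real_of_int t \<ge> T\<^sub>0 \<Longrightarrow>
           J\<^sub>1 * real_of_int t powr chi \<le> r t \<and> r t \<le> J\<^sub>2 * real_of_int t powr chi"
    and "(r has_sum 0) UNIV"
    and "\<alpha> > 1"
  shows "\<exists>lam\<^sub>0>0. \<forall>lam. 0 < lam \<and> lam < lam\<^sub>0 \<longrightarrow>
           limsup (\<lambda>T. max_profit M Z lam \<alpha> T /
             ereal (real T powr ((chi / 2 + 1) * (1 + 1 / (\<alpha> - 1)) + 1))) < \<infinity> \<and>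
           liminf (\<lambda>T. ext_expectation M (terminal_cash Z lam \<alpha> T (contrarian_strategy Z T \<alpha>)) /
             ereal (real T powr ((chi / 2 + 1) * (1 + 1 / (\<alpha> - 1)) + 1))) > 0"
proof -
  interpret prob_space M by fact
  interpret anti_persistent_noise M Z r T\<^sub>0 J\<^sub>1 J\<^sub>2 chi \<alpha>
    by unfold_locales (use assms in auto)
  have exponent: "(chi / 2 + 1) * (1 + 1 / (\<alpha> - 1)) + 1 = p + 1"
    by (simp add: p_def \<beta>_def)
  obtain lam\<^sub>0 c where lam0: "lam\<^sub>0 > 0" "c > 0" and lower: "\<And>lam. 0 < lam \<Longrightarrow> lam < lam\<^sub>0 \<Longrightarrow>
    \<forall>\<^sub>F T in sequentially. ereal (c * real T powr (p + 1)) \<le>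
      ext_expectation M (terminal_cash Z lam \<alpha> T (contrarian_strategy Z T \<alpha>))"
    using contrarian_profit_growth by blast
  have "limsup (\<lambda>T. max_profit M Z lam \<alpha> T / ereal (real T powr (p + 1))) < \<infinity> \<and>
      liminf (\<lambda>T. ext_expectation M (terminal_cash Z lam \<alpha> T (contrarian_strategy Z T \<alpha>)) /
        ereal (real T powr (p + 1))) > 0" if lam: "0 < lam" "lam < lam\<^sub>0" for lam
  proof
    obtain C where C: "\<And>T. max_profit M Z lam \<alpha> T \<le> ereal (C * real T powr (p + 1))"
      using max_profit_upper[OF lam(1)] by blast
    \<comment> \<open>T = 0 is discarded because the normalising power is 0 there.\<close>
    have "\<forall>\<^sub>F T in sequentially. max_profit M Z lam \<alpha> T / ereal (real T powr (p + 1)) \<le> ereal C"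
      using eventually_gt_at_top[of 0]
    proof eventually_elim
      case (elim T)
      then show ?case
        using C[of T] by (subst ereal_divide_le_pos) (auto simp: mult.commute)
    qed
    then have "limsup (\<lambda>T. max_profit M Z lam \<alpha> T / ereal (real T powr (p + 1))) \<le> ereal C"
      by (rule Limsup_bounded)
    then show "limsup (\<lambda>T. max_profit M Z lam \<alpha> T / ereal (real T powr (p + 1))) < \<infinity>"
      by (rule order_le_less_trans) simp
    have "\<forall>\<^sub>F T in sequentially. ereal c \<le>
        ext_expectation M (terminal_cash Z lam \<alpha> T (contrarian_strategy Z T \<alpha>)) / ereal (real T powr (p + 1))"
      using lower[OF lam] eventually_gt_at_top[of 0]
    proof eventually_elim
      case (elim T)
      then show ?case
        by (subst ereal_le_divide_pos) (auto simp: mult.commute)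
    qed
    then have "ereal c \<le> liminf (\<lambda>T. ext_expectation M (terminal_cash Z lam \<alpha> T (contrarian_strategy Z T \<alpha>)) /
        ereal (real T powr (p + 1)))"
      by (rule Liminf_bounded)
    moreover have "0 < ereal c" using \<open>c > 0\<close> by simp
    ultimately show "0 < liminf (\<lambda>T. ext_expectation M (terminal_cash Z lam \<alpha> T (contrarian_strategy Z T \<alpha>)) /
        ereal (real T powr (p + 1)))"
      by (rule less_le_trans[rotated])
  qed
  then show ?thesis
    unfolding exponent using lam0(1) by (intro exI[of _ lam\<^sub>0]) simp
qed

end
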